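(* Let $\mathcal{G}=(\mathcal{V},\mathcal{E})$ be a strongly connected digraph and let $\{\mathbf{y}(k)=(y_i(k))_{i=1}^N\}_{k\in\mathbb{Z}_+}$ be generated by the distributed quantized average consensus and weight-balancing algorithm described in the context, where: the step-size $\gamma(k)=2^{-n}$ for $2^n-1\le k\le 2^{n+1}-2$, $n\in\mathbb{Z}_+$; the average $\bar{y}(0)=\frac1N\sum_{i=1}^N y_i(0)$ satisfies $\bar y(0)\in[q_{\min},q_{\max}]$; and the step-size $\{\alpha(k)\}$ satisfies $\alpha(k)>0$, $\alpha(k+1)\le\alpha(k)$ for all $k$, $\sum_{k\ge1}\alpha(k)=\infty$ and $\sum_{k\ge1}\alpha(k)^2<\infty$. Then (a) $\mathbb{P}\left(\lim_{k\to\infty}\mathbf{y}(k)=\bar y(0)\mathbf{1}\right)=1$, and (b) $\lim_{k\to\infty}\mathbb{E}\left[\Vert\mathbf{y}(k)-\bar y(0)\mathbf{1}\Vert^2\right]=0$.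
   Context: $\mathcal{G}=(\mathcal{V},\mathcal{E})$, $\mathcal{V}=\{1,\dots,N\}$, is a directed graph without self-loops; in-neighbors $\mathcal{N}_i^-=\{j:(j,i)\in\mathcal{E}\}$, out-neighbors $\mathcal{N}_i^+=\{j:(i,j)\in\mathcal{E}\}$, $d_i^+=|\mathcal{N}_i^+|$. Strongly connected: directed path between every ordered pair of nodes. Algorithm: given $q_{\min}<q_{\max}$, arbitrary real initial values $y_i(0)$, initialize $a_{ij}(0)=1$ if $j\in\mathcal{N}_i^-$ and $0$ otherwise. At iteration $k$, let $b_i(k)=\sum_{j\in\mathcal{N}_i^-}a_{ij}(k)-\sum_{j\in\mathcal{N}_i^+}a_{ji}(k)$. Each node $i$ broadcasts to its out-neighbors $n_i(k)=\mathcal{I}\{b_i(k)\ge d_i^+\gamma(k)\}$ and a random $x_i(k)$ which equals $q_{\max}$ with probability $p_i(k)=\frac{\tilde y_i(k)-q_{\min}}{q_{\max}-q_{\min}}$ and $q_{\min}$ with probability $1-p_i(k)$, where $\tilde y_i(k)=\min\{\max\{y_i(k),q_{\min}\},q_{\max}\}$. Then node $i$ updates $a_{ij}(k+1)=a_{ij}(k)+n_j(k)\gamma(k)$ for $j\in\mathcal{N}_i^-$ and $y_i(k+1)=y_i(k)+\alpha(k)\sum_{j\in\mathcal{N}_i^-}a_{ij}(k)\big(x_j(k)-x_i(k)\big)+\alpha(k)b_i(k)x_i(k)$. *)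

theory Defs
  imports "HOL-Probability.Probability"
begin

text \<open>In-neighbours of i: {j. (j,i) \<in> E}; out-neighbours: {j. (i,j) \<in> E}.\<close>

definition strongly_connected :: "('v \<times> 'v) set \<Rightarrow> bool" where
  "strongly_connected E \<longleftrightarrow> (\<forall>i j. (i, j) \<in> E\<^sup>*)"

definition out_deg :: "('v \<times> 'v) set \<Rightarrow> 'v::finite \<Rightarrow> real" where
  "out_deg E i = real (card {j. (i, j) \<in> E})"

text \<open>Imbalance b_i for a weight assignment A (A i j = a_ij).\<close>
definition imbalance :: "('v \<times> 'v) set \<Rightarrow> ('v \<Rightarrow> 'v \<Rightarrow> real) \<Rightarrow> 'v::finite \<Rightarrow> real" where
  "imbalance E A i = (\<Sum>j\<in>{j. (j, i) \<in> E}. A i j) - (\<Sum>j\<in>{j. (i, j) \<in> E}. A j i)"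

text \<open>Weights a_ij(k) (deterministic).\<close>
primrec weights :: "('v \<times> 'v) set \<Rightarrow> (nat \<Rightarrow> real) \<Rightarrow> nat \<Rightarrow> 'v::finite \<Rightarrow> 'v \<Rightarrow> real" where
  "weights E \<gamma> 0 i j = (if (j, i) \<in> E then 1 else 0)"
| "weights E \<gamma> (Suc k) i j =
     (if (j, i) \<in> E then
        weights E \<gamma> k i j +
        (if imbalance E (weights E \<gamma> k) j \<ge> out_deg E j * \<gamma> k then 1 else 0) * \<gamma> k
      else weights E \<gamma> k i j)"

text \<open>Randomized quantizer: driven by a uniform sample u in [0,1], it returns q_max with
  probability p = (clip(y) - q_min)/(q_max - q_min) and q_min otherwise.\<close>
definition clip :: "real \<Rightarrow> real \<Rightarrow> real \<Rightarrow> real" where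
  "clip qmin qmax v = min (max v qmin) qmax"

definition quant :: "real \<Rightarrow> real \<Rightarrow> real \<Rightarrow> real \<Rightarrow> real" where
  "quant qmin qmax v u =
     (if u < (clip qmin qmax v - qmin) / (qmax - qmin) then qmax else qmin)"

text \<open>States y_i(k)(\<omega>); \<omega> (k,i) is the uniform sample used by node i at time k.\<close>
primrec states :: "('v \<times> 'v) set \<Rightarrow> (nat \<Rightarrow> real) \<Rightarrow> (nat \<Rightarrow> real) \<Rightarrow> real \<Rightarrow> real \<Rightarrow>
    ('v \<Rightarrow> real) \<Rightarrow> nat \<Rightarrow> (nat \<times> 'v \<Rightarrow> real) \<Rightarrow> 'v::finite \<Rightarrow> real" where
  "states E \<gamma> \<alpha> qmin qmax y0 0 \<omega> i = y0 i"
| "states E \<gamma> \<alpha> qmin qmax y0 (Suc k) \<omega> i =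
     (let x = (\<lambda>j. quant qmin qmax (states E \<gamma> \<alpha> qmin qmax y0 k \<omega> j) (\<omega> (k, j)));
          A = weights E \<gamma> k
      in states E \<gamma> \<alpha> qmin qmax y0 k \<omega> i
         + \<alpha> k * (\<Sum>j\<in>{j. (j, i) \<in> E}. A i j * (x j - x i))
         + \<alpha> k * imbalance E A i * x i)"

end

theory Submission
  imports Defs
begin

text \<open>
  The weights are \<open>a\<^sub>i\<^sub>j = w\<^sub>j\<close> on edges. A stationary distribution of the random walk on the graph gives a
  balanced weight vector \<open>v \<ge> 1\<close>, and \<open>w(k) \<le> v\<close> is invariant. Hence the total step size spent on
  firings is finite, while the steps of the window \<open>[k/2, k)\<close> add up to a constant; so for large \<open>k\<close> some
  time in this window is quiet, and since the total positive imbalance never grows, it is \<open>O(1/k)\<close>, thus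
  square summable.

  For the states put \<open>V = \<Sum>\<^sub>i (y\<^sub>i - c)\<^sup>2\<close>, \<open>c\<close> the conserved average, and let \<open>Q\<close> be the sum over the edges
  of the squared differences of clipped states. Convexity of the antiderivative of the clipping map gives
  \<open>E[V(k+1) | past] \<le> V + \<beta>\<^sub>k (1 + V) - \<alpha>\<^sub>k Q\<close> with \<open>\<beta>\<close> summable. So \<open>\<Sum> \<alpha>\<^sub>k E Q(k)\<close> is finite and
  \<open>E Q\<close> is small infinitely often; as \<open>V\<close> is controlled by \<open>Q\<close> and by the bounded moment \<open>E V\<^sup>2\<close>, so is
  \<open>E V\<close>. Monotonicity of the rescaled mean yields \<open>E V \<rightarrow> 0\<close>, and the maximal inequality for nonnegative
  supermartingales turns this into almost sure convergence.
\<close>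

section \<open>Weight balancing\<close>

lemma sum_in_edges:
  fixes E :: "('v::finite \<times> 'v) set" and F :: "'v \<Rightarrow> 'v \<Rightarrow> real"
  shows "(\<Sum>i\<in>UNIV. \<Sum>j\<in>{j. (j, i) \<in> E}. F j i) = (\<Sum>(j, i)\<in>E. F j i)"
proof -
  have "(\<Sum>i\<in>UNIV. \<Sum>j\<in>{j. (j, i) \<in> E}. F j i) = (\<Sum>(i, j)\<in>E\<inverse>. F j i)"
    by (subst sum.Sigma) (auto intro!: sum.cong)
  also have "\<dots> = (\<Sum>(j, i)\<in>E. F j i)"
    by (rule sum.reindex_bij_witness[of _ prod.swap prod.swap]) auto
  finally show ?thesis .
qed

lemma sum_out_edges:
  fixes E :: "('v::finite \<times> 'v) set" and F :: "'v \<Rightarrow> 'v \<Rightarrow> real"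
  shows "(\<Sum>i\<in>UNIV. \<Sum>j\<in>{j. (i, j) \<in> E}. F i j) = (\<Sum>(i, j)\<in>E. F i j)"
  by (subst sum.Sigma) (auto intro!: sum.cong)

text \<open>Summation by parts: the weight of an edge counts positively at its head and negatively
  at its tail, so \<open>g\<close> enters only through its differences along edges.\<close>

lemma sum_mult_imbalance:
  fixes E :: "('v::finite \<times> 'v) set"
  shows "(\<Sum>i\<in>UNIV. g i * imbalance E A i) = (\<Sum>(j, i)\<in>E. A i j * (g i - g j))"
proof -
  have "(\<Sum>i\<in>UNIV. g i * imbalance E A i) =
      (\<Sum>i\<in>UNIV. \<Sum>j\<in>{j. (j, i) \<in> E}. g i * A i j) - (\<Sum>i\<in>UNIV. \<Sum>j\<in>{j. (i, j) \<in> E}. g i * A j i)"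
    by (simp add: imbalance_def right_diff_distrib sum_distrib_left sum_subtractf)
  then show ?thesis
    unfolding sum_in_edges[where F = "\<lambda>j i. g i * A i j"] sum_out_edges[where F = "\<lambda>i j. g i * A j i"]
    by (simp add: sum_subtractf[symmetric] case_prod_beta' algebra_simps)
qed

lemma sum_imbalance: "(\<Sum>i\<in>UNIV. imbalance E A i) = 0"
  using sum_mult_imbalance[where g = "\<lambda>_. 1" and E = E and A = A] by simp

section \<open>A strictly positive balanced weight vector\<close>

lemma out_deg_pos:
  fixes E :: "('v::finite \<times> 'v) set"
  assumes "strongly_connected E" "E \<noteq> {}"
  shows "out_deg E i > 0"
proof -
  obtain a b where ab: "(a, b) \<in> E" using assms(2) by auto
  have "\<exists>j. (i, j) \<in> E"
  proof (cases "i = a")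
    case False
    have "(i, a) \<in> E\<^sup>*" using assms(1) by (auto simp: strongly_connected_def)
    then show ?thesis using False by (metis converse_rtranclE)
  qed (use ab in auto)
  then have "card {j. (i, j) \<in> E} > 0" by (auto simp: card_gt_0_iff)
  then show ?thesis by (simp add: out_deg_def)
qed

text \<open>The random walk that leaves each node along a uniformly chosen out-edge maps the
  probability simplex continuously into itself; Brouwer's theorem gives a fixed point.\<close>

lemma stationary_distribution_exists:
  fixes E :: "('v::finite \<times> 'v) set"
  assumes deg: "\<And>i. out_deg E i > 0"
  obtains u :: "'v \<Rightarrow> real" where "\<And>i. u i \<ge> 0" "(\<Sum>i\<in>UNIV. u i) = 1"
    "\<And>i. (\<Sum>j\<in>{j. (j, i) \<in> E}. u j / out_deg E j) = u i"
proof -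
  define S :: "(real ^ 'v) set" where "S = {x. (\<forall>i. 0 \<le> x $ i) \<and> (\<Sum>i\<in>UNIV. x $ i) = 1}"
  define T :: "real ^ 'v \<Rightarrow> real ^ 'v"
    where "T x = (\<chi> i. \<Sum>j\<in>{j. (j, i) \<in> E}. x $ j / out_deg E j)" for x
  have "closed S"
    unfolding S_def by (intro closed_Collect_conj closed_Collect_all closed_Collect_le closed_Collect_eq continuous_intros)
  moreover have "bounded S"
  proof (rule boundedI)
    fix x assume x: "x \<in> S"
    have "norm x \<le> (\<Sum>i\<in>UNIV. \<bar>x $ i\<bar>)" by (rule norm_le_l1_cart)
    also have "\<dots> = 1" using x by (simp add: S_def)
    finally show "norm x \<le> 1" .
  qed
  ultimately have "compact S" by (simp add: compact_eq_bounded_closed)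
  moreover have "convex S"
    unfolding S_def convex_def
    by (auto simp: sum.distrib sum_distrib_left[symmetric] intro!: add_nonneg_nonneg mult_nonneg_nonneg)
  moreover have "(\<chi> i. 1 / real CARD('v)) \<in> S" by (simp add: S_def)
  then have "S \<noteq> {}" by blast
  moreover have "continuous_on S T"
    unfolding T_def by (intro continuous_intros) (use deg in \<open>auto simp: less_imp_neq[symmetric]\<close>)
  moreover have "T \<in> S \<rightarrow> S"
  proof
    fix x assume x: "x \<in> S"
    have "(\<Sum>i\<in>UNIV. T x $ i) = (\<Sum>(j, i)\<in>E. x $ j / out_deg E j)"
      unfolding T_def by (simp add: sum_in_edges[where F = "\<lambda>j i. x $ j / out_deg E j"])
    also have "\<dots> = (\<Sum>j\<in>UNIV. \<Sum>i\<in>{i. (j, i) \<in> E}. x $ j / out_deg E j)"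
      by (rule sum_out_edges[symmetric])
    also have "\<dots> = (\<Sum>j\<in>UNIV. x $ j)"
    proof (rule sum.cong)
      fix j show "(\<Sum>i\<in>{i. (j, i) \<in> E}. x $ j / out_deg E j) = x $ j"
        using deg[of j] by (auto simp: out_deg_def card_gt_0_iff)
    qed simp
    finally have "(\<Sum>i\<in>UNIV. T x $ i) = 1" using x by (simp add: S_def)
    moreover have "0 \<le> T x $ i" for i
      using x less_imp_le[OF deg] by (auto simp: T_def S_def intro!: sum_nonneg)
    ultimately show "T x \<in> S" by (auto simp: S_def)
  qed
  ultimately obtain x where x: "x \<in> S" "T x = x" by (rule brouwer)
  show thesis
  proof
    show "(\<Sum>i\<in>UNIV. x $ i) = 1" "\<And>i. x $ i \<ge> 0" using x by (auto simp: S_def)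
    show "(\<Sum>j\<in>{j. (j, i) \<in> E}. x $ j / out_deg E j) = x $ i" for i
      using arg_cong[OF x(2), of "\<lambda>x. x $ i"] by (simp add: T_def)
  qed
qed

lemma balanced_weights_exist:
  fixes E :: "('v::finite \<times> 'v) set"
  assumes sc: "strongly_connected E" and ne: "E \<noteq> {}"
  obtains v :: "'v \<Rightarrow> real" where "\<And>i. v i \<ge> 1"
    "\<And>i. (\<Sum>j\<in>{j. (j, i) \<in> E}. v j) = out_deg E i * v i"
proof -
  note deg = out_deg_pos[OF sc ne]
  obtain u :: "'v \<Rightarrow> real" where u: "\<And>i. u i \<ge> 0" "(\<Sum>i\<in>UNIV. u i) = 1"
    "\<And>i. (\<Sum>j\<in>{j. (j, i) \<in> E}. u j / out_deg E j) = u i"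
    using stationary_distribution_exists[OF deg] by blast
  obtain a where a: "u a > 0"
    using u(1,2) by (metis less_eq_real_def sum.neutral zero_neq_one)
  \<comment> \<open>Stationarity pushes positive mass along edges, so it spreads from
    \<open>a\<close> to every node reachable from it.\<close>
  have pos: "u i > 0" for i
  proof -
    have "(a, i) \<in> E\<^sup>*" using sc by (auto simp: strongly_connected_def)
    then show ?thesis
    proof (induction rule: rtrancl_induct)
      case (step j i)
      have "0 < u j / out_deg E j" using step.IH deg by simp
      also have "\<dots> \<le> (\<Sum>j\<in>{j. (j, i) \<in> E}. u j / out_deg E j)"
        by (rule member_le_sum) (use step u(1) less_imp_le[OF deg] in auto)
      finally show ?case using u(3) by simp
    qed (rule a)
  qed
  \<comment> \<open>Dividing by the out-degree turns stationarity into balance. Scaling by the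
    minimum \<open>m\<close> then lifts the vector above the initial weights, which are all
    1.\<close>
  define v where "v i = u i / out_deg E i" for i
  define m where "m = Min (range v)"
  have vpos: "v i > 0" for i using pos deg by (simp add: v_def)
  have m: "m > 0" "\<And>i. m \<le> v i"
    using vpos by (auto simp: m_def)
  show thesis
  proof
    show "v i / m \<ge> 1" for i using m by simp
    show "(\<Sum>j\<in>{j. (j, i) \<in> E}. v j / m) = out_deg E i * (v i / m)" for i
      using u(3)[of i] deg[of i] by (simp add: v_def flip: sum_divide_distrib divide_divide_eq_left)
  qed
qed

text \<open>All edges leaving \<open>j\<close> carry the same weight.\<close>

primrec node_weight :: "('v \<times> 'v) set \<Rightarrow> (nat \<Rightarrow> real) \<Rightarrow> nat \<Rightarrow> 'v::finite \<Rightarrow> real" where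
  "node_weight E \<gamma> 0 j = 1"
| "node_weight E \<gamma> (Suc k) j = node_weight E \<gamma> k j +
     (if imbalance E (weights E \<gamma> k) j \<ge> out_deg E j * \<gamma> k then \<gamma> k else 0)"

section \<open>Common out-edge weights, firings and the decay of the imbalance\<close>

lemma weights_eq: "weights E \<gamma> k i j = (if (j, i) \<in> E then node_weight E \<gamma> k j else 0)"
  by (induction k) auto

lemma imbalance_weights:
  "imbalance E (weights E \<gamma> k) i =
     (\<Sum>j\<in>{j. (j, i) \<in> E}. node_weight E \<gamma> k j) - out_deg E i * node_weight E \<gamma> k i"
  by (simp add: imbalance_def weights_eq out_deg_def)

text \<open>The broadcast bit n_i(k) of the algorithm, real-valued so that it multiplies the step
  directly.\<close>

definition firing :: "('v \<times> 'v) set \<Rightarrow> (nat \<Rightarrow> real) \<Rightarrow> nat \<Rightarrow> 'v::finite \<Rightarrow> real" where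
  "firing E \<gamma> k i = (if imbalance E (weights E \<gamma> k) i \<ge> out_deg E i * \<gamma> k then 1 else 0)"

lemma node_weight_Suc: "node_weight E \<gamma> (Suc k) j = node_weight E \<gamma> k j + firing E \<gamma> k j * \<gamma> k"
  by (simp add: firing_def)

lemma imbalance_weights_Suc:
  "imbalance E (weights E \<gamma> (Suc k)) i = imbalance E (weights E \<gamma> k) i
     - out_deg E i * firing E \<gamma> k i * \<gamma> k + (\<Sum>j\<in>{j. (j, i) \<in> E}. firing E \<gamma> k j * \<gamma> k)"
  unfolding imbalance_weights node_weight_Suc by (simp add: sum.distrib algebra_simps)

text \<open>As the imbalances sum to zero, this is half of their total absolute value. It is the
  Lyapunov function of the balancing dynamics.\<close>

definition surplus :: "('v::finite \<times> 'v) set \<Rightarrow> (nat \<Rightarrow> real) \<Rightarrow> nat \<Rightarrow> real" where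
  "surplus E \<gamma> k = (\<Sum>i\<in>UNIV. max 0 (imbalance E (weights E \<gamma> k) i))"

lemma surplus_nonneg: "surplus E \<gamma> k \<ge> 0"
  by (simp add: surplus_def sum_nonneg)

lemma sum_abs_imbalance: "(\<Sum>i\<in>UNIV. \<bar>imbalance E (weights E \<gamma> k) i\<bar>) = 2 * surplus E \<gamma> k"
proof -
  have "(\<Sum>i\<in>UNIV. \<bar>imbalance E (weights E \<gamma> k) i\<bar>) =
      (\<Sum>i\<in>UNIV. 2 * max 0 (imbalance E (weights E \<gamma> k) i) - imbalance E (weights E \<gamma> k) i)"
    by (rule sum.cong) auto
  then show ?thesis
    by (simp add: sum_subtractf sum_imbalance surplus_def sum_distrib_left)
qed

lemma sum_out_deg: "(\<Sum>i\<in>UNIV. out_deg E i * f i) = (\<Sum>i\<in>UNIV. \<Sum>j\<in>{j. (j, i) \<in> E}. f j)"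
  using sum_out_edges[of "\<lambda>i j. f i" E] sum_in_edges[of "\<lambda>i j. f i" E] by (simp add: out_deg_def)

text \<open>A node fires only if its imbalance covers what it gives away, so its positive part drops
  by exactly that amount. Receiving raises a positive part by at most the amount received, and the
  amounts given and received agree in total.\<close>

lemma surplus_Suc_le:
  assumes "\<gamma> k \<ge> 0"
  shows "surplus E \<gamma> (Suc k) \<le> surplus E \<gamma> k"
proof -
  let ?b = "\<lambda>k. imbalance E (weights E \<gamma> k)" and ?f = "\<lambda>i. firing E \<gamma> k i * \<gamma> k"
  let ?in = "\<lambda>i. \<Sum>j\<in>{j. (j, i) \<in> E}. ?f j"
  have f: "?f i \<ge> 0" for i using assms by (simp add: firing_def)
  have "surplus E \<gamma> (Suc k) \<le> (\<Sum>i\<in>UNIV. max 0 (?b k i) - out_deg E i * ?f i + ?in i)"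
    unfolding surplus_def
  proof (rule sum_mono)
    fix i
    have "?in i \<ge> 0" using f by (intro sum_nonneg) auto
    moreover have "out_deg E i * \<gamma> k \<ge> 0" using assms by (simp add: out_deg_def)
    ultimately show "max 0 (?b (Suc k) i) \<le> max 0 (?b k i) - out_deg E i * ?f i + ?in i"
      unfolding imbalance_weights_Suc by (auto simp: firing_def)
  qed
  also have "\<dots> = surplus E \<gamma> k"
    unfolding sum.distrib sum_subtractf sum_out_deg surplus_def by simp
  finally show ?thesis .
qed

lemma surplus_no_firing:
  fixes E :: "('v::finite \<times> 'v) set"
  assumes "\<gamma> k \<ge> 0" "\<And>i. firing E \<gamma> k i = 0"
  shows "surplus E \<gamma> k \<le> (\<Sum>i\<in>UNIV. out_deg E i) * \<gamma> k"
  unfolding surplus_def sum_distrib_right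
proof (rule sum_mono)
  fix i :: 'v
  show "max 0 (imbalance E (weights E \<gamma> k) i) \<le> out_deg E i * \<gamma> k"
    using assms(2)[of i] assms(1) by (auto simp: firing_def out_deg_def split: if_splits)
qed

text \<open>The firing threshold makes \<open>v\<close> a barrier: if \<open>i\<close> fires, then
  out-degree times new weight is at most the current inflow, hence at most the inflow under
  \<open>v\<close>, which is out-degree times \<open>v i\<close>.\<close>

lemma node_weight_le:
  assumes "\<And>i. v i \<ge> 1" "\<And>i. (\<Sum>j\<in>{j. (j, i) \<in> E}. v j) = out_deg E i * v i"
    and "\<And>i. out_deg E i > 0"
  shows "node_weight E \<gamma> k i \<le> v i"
proof (induction k arbitrary: i)
  case (Suc k)
  show ?case
  proof (cases "imbalance E (weights E \<gamma> k) i \<ge> out_deg E i * \<gamma> k")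
    case True
    have "(\<Sum>j\<in>{j. (j, i) \<in> E}. node_weight E \<gamma> k j) \<le> (\<Sum>j\<in>{j. (j, i) \<in> E}. v j)"
      by (rule sum_mono) (rule Suc)
    then have "out_deg E i * (node_weight E \<gamma> k i + \<gamma> k) \<le> out_deg E i * v i"
      using True by (simp add: imbalance_weights assms(2) algebra_simps)
    then have "node_weight E \<gamma> k i + \<gamma> k \<le> v i" using assms(3) by (simp add: mult_le_cancel_left_pos)
    then show ?thesis using True by simp
  qed (use Suc in auto)
qed (use assms in auto)

lemma node_weight_ge_1: "(\<And>k. \<gamma> k \<ge> 0) \<Longrightarrow> node_weight E \<gamma> k i \<ge> 1"
  by (induction k) (auto intro: add_increasing2)

lemma node_weight_eq: "node_weight E \<gamma> k i = 1 + (\<Sum>l<k. firing E \<gamma> l i * \<gamma> l)"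
  by (induction k) (simp_all add: node_weight_Suc del: node_weight.simps(2))

text \<open>The partial sums at a node are its weight minus 1, hence bounded through the barrier
  \<open>v\<close>.\<close>

lemma summable_firing:
  assumes v: "\<And>i. v i \<ge> 1" "\<And>i. (\<Sum>j\<in>{j. (j, i) \<in> E}. v j) = out_deg E i * v i"
    and d: "\<And>i. out_deg E i > 0" and g: "\<And>k. \<gamma> k \<ge> 0"
  shows "summable (\<lambda>k. \<Sum>i\<in>UNIV. firing E \<gamma> k i * \<gamma> k)"
proof (rule summable_sum)
  fix i
  show "summable (\<lambda>k. firing E \<gamma> k i * \<gamma> k)"
  proof (rule summableI_nonneg_bounded)
    show "0 \<le> firing E \<gamma> k i * \<gamma> k" for k using g by (simp add: firing_def)
    show "(\<Sum>l<k. firing E \<gamma> l i * \<gamma> l) \<le> v i" for k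
      using node_weight_le[of v E \<gamma> k i, OF v d] unfolding node_weight_eq by simp
  qed
qed

text \<open>The firings in \<open>[n, 2 n)\<close> cannot use up the whole step-size mass of that window, so some time
  in it is quiet.\<close>

lemma surplus_rate:
  fixes E :: "('v::finite \<times> 'v) set"
  assumes v: "\<And>i. v i \<ge> 1" "\<And>i. (\<Sum>j\<in>{j. (j, i) \<in> E}. v j) = out_deg E i * v i"
    and d: "\<And>i. out_deg E i > 0"
    and g: "\<And>k. 1 / (real k + 1) \<le> \<gamma> k" "\<And>k. \<gamma> k \<le> 2 / (real k + 1)"
  shows "\<forall>\<^sub>F k in sequentially. surplus E \<gamma> k \<le> 6 * (\<Sum>i\<in>UNIV. out_deg E i) / (real k + 1)"
proof -
  have g0: "\<gamma> k \<ge> 0" for k using g(1)[of k] by (rule order_trans[rotated]) simp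
  let ?f = "\<lambda>k. \<Sum>i\<in>UNIV. firing E \<gamma> k i * \<gamma> k"
  have f0: "?f k \<ge> 0" for k using g0 by (auto simp: firing_def intro!: sum_nonneg)
  \<comment> \<open>A window \<open>[n, 2 n)\<close> with a firing at every time would contribute
    \<open>n\<close> terms of size at least \<open>1 / (2 n)\<close>, that is 1/2 in all.\<close>
  obtain K where K: "\<And>m n. m \<ge> K \<Longrightarrow> norm (sum ?f {m..<n}) < 1/2"
    using summable_firing[OF v d g0] unfolding summable_Cauchy by (meson zero_less_divide_1_iff zero_less_numeral)
  have anti: "surplus E \<gamma> n \<le> surplus E \<gamma> m" if "m \<le> n" for m n
    using that by (rule lift_Suc_antimono_le[rotated]) (rule surplus_Suc_le[OF g0])
  have D: "0 \<le> (\<Sum>i\<in>UNIV. out_deg E i)" by (simp add: out_deg_def sum_nonneg)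
  have "surplus E \<gamma> k \<le> 6 * (\<Sum>i\<in>UNIV. out_deg E i) / (real k + 1)" if k: "k \<ge> 2 * K + 2" for k
  proof -
    define n where "n = k div 2"
    have n: "n \<ge> K" "n \<ge> 1" "2 * n \<le> k" "k \<le> 2 * n + 1" using k by (auto simp: n_def)
    have "\<exists>l\<in>{n..<2*n}. \<forall>i. firing E \<gamma> l i = 0"
    proof (rule ccontr)
      assume *: "\<not> ?thesis"
      have "1 / (2 * real n) \<le> ?f l" if l: "l \<in> {n..<2*n}" for l
      proof -
        obtain i where "firing E \<gamma> l i \<noteq> 0" using * l by blast
        then have i: "firing E \<gamma> l i = 1" by (simp add: firing_def split: if_splits)
        have "1 / (2 * real n) \<le> 1 / (real l + 1)" using l by (intro divide_left_mono) auto
        also have "\<dots> \<le> \<gamma> l" by (rule g)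
        also have "\<dots> = firing E \<gamma> l i * \<gamma> l" using i by simp
        also have "\<dots> \<le> ?f l" by (rule member_le_sum) (use g0 in \<open>auto simp: firing_def\<close>)
        finally show ?thesis .
      qed
      then have "(\<Sum>l\<in>{n..<2*n}. 1 / (2 * real n)) \<le> sum ?f {n..<2*n}" by (rule sum_mono)
      then show False using K[OF n(1), of "2 * n"] n(2) by simp
    qed
    then obtain l where l: "n \<le> l" "l < 2 * n" "\<And>i. firing E \<gamma> l i = 0" by auto
    have "surplus E \<gamma> k \<le> surplus E \<gamma> l" using l n by (intro anti) auto
    also have "\<dots> \<le> (\<Sum>i\<in>UNIV. out_deg E i) * \<gamma> l" using surplus_no_firing[of \<gamma> l E] g0 l by auto
    also have "\<dots> \<le> (\<Sum>i\<in>UNIV. out_deg E i) * (6 / (real k + 1))"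
    proof (rule mult_left_mono)
      have "\<gamma> l \<le> 2 / (real l + 1)" by (rule g)
      \<comment> \<open>From \<open>k \<le> 2 * n + 1\<close> and \<open>n \<le> l\<close> follows
        \<open>k + 1 \<le> 2 * (l + 1)\<close>, which leaves room in the constant 6.\<close>
      also have "\<dots> \<le> 6 / (real k + 1)" using l n by (simp add: divide_simps)
      finally show "\<gamma> l \<le> 6 / (real k + 1)" .
    qed (rule D)
    finally show ?thesis by (simp add: mult.commute)
  qed
  then show ?thesis unfolding eventually_sequentially by blast
qed

lemma summable_inverse_square_Suc: "summable (\<lambda>k. (c / (real k + 1))\<^sup>2)"
proof -
  have "summable (\<lambda>k. c\<^sup>2 * (1 / real (Suc k) ^ 2))"
    using inverse_power_summable[of 2, where 'a = real]
    by (intro summable_mult) (subst summable_Suc_iff, simp add: divide_inverse)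
  then show ?thesis by (simp add: power_divide algebra_simps)
qed

text \<open>The imbalance is O(1/k), so its squares are summable. This is the form that pairs with
  the square summable \<alpha>.\<close>

lemma summable_imbalance_sq:
  fixes E :: "('v::finite \<times> 'v) set"
  assumes sc: "strongly_connected E"
    and g: "\<And>k. 1 / (real k + 1) \<le> \<gamma> k" "\<And>k. \<gamma> k \<le> 2 / (real k + 1)"
  shows "summable (\<lambda>k. (\<Sum>i\<in>UNIV. \<bar>imbalance E (weights E \<gamma> k) i\<bar>)\<^sup>2)"
\<comment> \<open>A strongly connected graph without edges has a single node. There the out-degrees
  vanish and so does every imbalance.\<close>
proof (cases "E = {}")
  case False
  obtain v :: "'v \<Rightarrow> real" where v: "\<And>i. v i \<ge> 1"
    "\<And>i. (\<Sum>j\<in>{j. (j, i) \<in> E}. v j) = out_deg E i * v i"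
    using balanced_weights_exist[OF sc False] by blast
  let ?D = "\<Sum>i\<in>UNIV. out_deg E i"
  have "\<forall>\<^sub>F k in sequentially. norm ((2 * surplus E \<gamma> k)\<^sup>2) \<le> (12 * ?D / (real k + 1))\<^sup>2"
    using surplus_rate[where \<gamma> = \<gamma>, OF v out_deg_pos[OF sc False] g]
  proof eventually_elim
    case (elim k)
    have "(2 * surplus E \<gamma> k)\<^sup>2 \<le> (12 * ?D / (real k + 1))\<^sup>2"
      using elim surplus_nonneg[of E \<gamma> k] by (intro power_mono) auto
    then show ?case by simp
  qed
  then show ?thesis unfolding sum_abs_imbalance
    by (rule summable_comparison_test_ev) (rule summable_inverse_square_Suc)
qed (simp add: imbalance_def)

lemma weights_bounds:
  fixes E :: "('v::finite \<times> 'v) set"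
  assumes sc: "strongly_connected E" and g: "\<And>k. \<gamma> k \<ge> 0"
  obtains C where "\<And>k i j. 0 \<le> weights E \<gamma> k i j" "\<And>k i j. weights E \<gamma> k i j \<le> C"
proof (cases "E = {}")
  case True
  then show thesis using that[of 0] by (simp add: weights_eq)
next
  case False
  obtain v :: "'v \<Rightarrow> real" where v: "\<And>i. v i \<ge> 1"
    "\<And>i. (\<Sum>j\<in>{j. (j, i) \<in> E}. v j) = out_deg E i * v i"
    using balanced_weights_exist[OF sc False] by blast
  have "node_weight E \<gamma> k j \<le> Max (range v)" for k j
    using node_weight_le[of v E \<gamma> k j, OF v out_deg_pos[OF sc False]] by (rule order_trans) simp
  moreover have "0 \<le> Max (range v)"
    by (rule order_trans[of _ "v undefined"]) (use v(1)[of undefined] in auto)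
  moreover have "0 \<le> node_weight E \<gamma> k j" for k j
    using node_weight_ge_1[of \<gamma> E k j, OF g] by linarith
  ultimately show thesis by (intro that[of "Max (range v)"]) (auto simp only: weights_eq split: if_splits)
qed

text \<open>Block \<open>n\<close> consists of the \<open>k\<close> with
  \<open>2 ^ n \<le> k + 1 < 2 ^ (n + 1)\<close>, so the dyadic step is the harmonic one up to a
  factor of two.\<close>

lemma dyadic_step_bounds:
  fixes \<gamma> :: "nat \<Rightarrow> real"
  assumes "\<forall>n k. 2 ^ n - 1 \<le> k \<and> k \<le> 2 ^ (n + 1) - 2 \<longrightarrow> \<gamma> k = 1 / 2 ^ n"
  shows "1 / (real k + 1) \<le> \<gamma> k" "\<gamma> k \<le> 2 / (real k + 1)"
proof -
  obtain n where n: "2 ^ n \<le> k + 1" "k + 1 < 2 ^ (n + 1)"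
    using ex_power_ivl1[of 2 "k + 1"] by auto
  then have "2 ^ n - 1 \<le> k" "k \<le> 2 ^ (n + 1) - 2" by linarith+
  then have g: "\<gamma> k = 1 / 2 ^ n" by (intro assms[rule_format] conjI)
  have "real (2 ^ n) \<le> real (k + 1)" "real (k + 1) \<le> real (2 * 2 ^ n)"
    using n by (simp_all only: of_nat_le_iff) simp
  then have "2 ^ n \<le> real k + 1" "real k + 1 \<le> 2 * 2 ^ n" by simp_all
  then show "1 / (real k + 1) \<le> \<gamma> k" "\<gamma> k \<le> 2 / (real k + 1)" unfolding g by (simp_all add: field_simps)
qed

section \<open>Descent of the deviation along the mean drift\<close>

text \<open>The update direction with the factor \<alpha> taken out. The vector \<open>x\<close> is
  left arbitrary because the drift is evaluated both at quantized and at clipped states.\<close>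

definition drift :: "('v::finite \<times> 'v) set \<Rightarrow> ('v \<Rightarrow> 'v \<Rightarrow> real) \<Rightarrow> ('v \<Rightarrow> real) \<Rightarrow> 'v \<Rightarrow> real" where
  "drift E A x i = (\<Sum>j\<in>{j. (j, i) \<in> E}. A i j * (x j - x i)) + imbalance E A i * x i"

lemma states_Suc:
  "states E \<gamma> \<alpha> qmin qmax y0 (Suc k) \<omega> i = states E \<gamma> \<alpha> qmin qmax y0 k \<omega> i
     + \<alpha> k * drift E (weights E \<gamma> k)
         (\<lambda>j. quant qmin qmax (states E \<gamma> \<alpha> qmin qmax y0 k \<omega> j) (\<omega> (k, j))) i"
  by (simp add: Let_def drift_def algebra_simps)

text \<open>The correction by the imbalance cancels the incoming weights in front of
  \<open>x i\<close>. What remains is a flow: edge \<open>(j, i)\<close> moves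
  \<open>A i j * x j\<close> from \<open>j\<close> to \<open>i\<close>, so the total is conserved
  even for unbalanced weights.\<close>

lemma drift_eq:
  "drift E A x i = (\<Sum>j\<in>{j. (j, i) \<in> E}. A i j * x j) - (\<Sum>j\<in>{j. (i, j) \<in> E}. A j i * x i)"
  by (simp add: drift_def imbalance_def right_diff_distrib left_diff_distrib sum_subtractf sum_distrib_right)

lemma sum_mult_drift: "(\<Sum>i\<in>UNIV. f i * drift E A x i) = (\<Sum>(j, i)\<in>E. A i j * x j * (f i - f j))"
proof -
  have "(\<Sum>i\<in>UNIV. f i * drift E A x i) =
      (\<Sum>i\<in>UNIV. \<Sum>j\<in>{j. (j, i) \<in> E}. f i * (A i j * x j)) - (\<Sum>i\<in>UNIV. \<Sum>j\<in>{j. (i, j) \<in> E}. f i * (A j i * x i))"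
    by (simp add: drift_eq right_diff_distrib sum_distrib_left sum_subtractf)
  then show ?thesis
    unfolding sum_in_edges[where F = "\<lambda>j i. f i * (A i j * x j)"]
      sum_out_edges[where F = "\<lambda>i j. f i * (A j i * x i)"]
    by (simp add: sum_subtractf[symmetric] case_prod_beta' algebra_simps)
qed

lemma sum_drift: "(\<Sum>i\<in>UNIV. drift E A x i) = 0"
  using sum_mult_drift[where f = "\<lambda>_. 1" and E = E and A = A and x = x] by simp

lemma sum_states: "(\<Sum>i\<in>UNIV. states E \<gamma> \<alpha> qmin qmax y0 k \<omega> i) = (\<Sum>i\<in>UNIV. y0 i)"
proof (induction k)
  case (Suc k)
  then show ?case
    unfolding states_Suc by (simp add: sum.distrib sum_distrib_left[symmetric] sum_drift)
qed simp

lemma abs_drift_le: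
  fixes E :: "('v::finite \<times> 'v) set"
  assumes A: "\<And>i j. 0 \<le> A i j" "\<And>i j. A i j \<le> C" and x: "\<And>i. \<bar>x i\<bar> \<le> m"
  shows "\<bar>drift E A x i\<bar> \<le> 2 * real CARD('v) * C * m"
proof -
  have C: "C \<ge> 0" using A(1)[of i i] A(2)[of i i] by linarith
  have m: "m \<ge> 0" using x[of i] by linarith
  have le: "\<bar>A a b * x c\<bar> \<le> C * m" for a b c
    unfolding abs_mult using A C x by (intro mult_mono) auto
  have bd: "\<bar>sum f S\<bar> \<le> real CARD('v) * (C * m)" if "\<And>j. \<bar>f j\<bar> \<le> C * m" for f :: "'v \<Rightarrow> real" and S
  proof -
    have "\<bar>sum f S\<bar> \<le> (\<Sum>j\<in>S. C * m)"
      by (rule order_trans[OF sum_abs]) (rule sum_mono, rule that)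
    also have "\<dots> \<le> (\<Sum>j\<in>(UNIV::'v set). C * m)" by (rule sum_mono2) (use C m in auto)
    finally show ?thesis by simp
  qed
  have "\<bar>drift E A x i\<bar> \<le> real CARD('v) * (C * m) + real CARD('v) * (C * m)"
    unfolding drift_eq by (rule order_trans[OF abs_triangle_ineq4]) (intro add_mono bd le)
  then show ?thesis by (simp add: algebra_simps)
qed

section \<open>Clipping as a projection, and its convex potential\<close>

lemma clip_bounds: "qmin \<le> qmax \<Longrightarrow> qmin \<le> clip qmin qmax v" "clip qmin qmax v \<le> qmax"
  by (auto simp: clip_def)

lemma abs_clip_le: "qmin \<le> qmax \<Longrightarrow> \<bar>clip qmin qmax v\<bar> \<le> \<bar>qmin\<bar> + \<bar>qmax\<bar>"
  by (auto simp: clip_def)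

text \<open>The variational inequality of the projection onto \<open>[qmin, qmax]\<close>, tested at
  the point \<open>clip qmin qmax v\<close> of that interval.\<close>

lemma clip_projection:
  assumes "qmin \<le> qmax"
  shows "(u - clip qmin qmax u) * (clip qmin qmax u - clip qmin qmax v) \<ge> 0"
  using assms by (auto simp: clip_def min_def max_def zero_le_mult_iff)

text \<open>An antiderivative of the clipping map; its Bregman divergence dominates the squared distance of
  the clipped values.\<close>

definition clip_potential :: "real \<Rightarrow> real \<Rightarrow> real \<Rightarrow> real" where
  "clip_potential qmin qmax v = v * clip qmin qmax v - (clip qmin qmax v)\<^sup>2 / 2"

text \<open>The gap between the two sides is exactly the product in
  \<open>clip_projection\<close>.\<close>

lemma clip_mult_diff_le:
  assumes "qmin \<le> qmax"
  shows "clip qmin qmax v * (u - v) \<le> clip_potential qmin qmax u - clip_potential qmin qmax v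
    - (clip qmin qmax u - clip qmin qmax v)\<^sup>2 / 2"
  using clip_projection[OF assms, of u v]
  by (simp add: clip_potential_def power2_eq_square field_simps)

text \<open>The potential grows only linearly. The quadratic bound is chosen so that the error
  caused by the imbalance becomes a multiple of one plus the squared deviation.\<close>

lemma abs_clip_potential_le:
  assumes "qmin \<le> c" "c \<le> qmax"
  defines "m \<equiv> \<bar>qmin\<bar> + \<bar>qmax\<bar>"
  shows "\<bar>clip_potential qmin qmax v\<bar> \<le> (m + 2 * m\<^sup>2) * (1 + (v - c)\<^sup>2)"
proof -
  let ?q = "clip qmin qmax v"
  have q: "\<bar>?q\<bar> \<le> m" using abs_clip_le[of qmin qmax v] assms by linarith
  have c: "\<bar>c\<bar> \<le> m" using assms by linarith
  have m: "m \<ge> 0" by (simp add: m_def)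
  have sq: "?q\<^sup>2 \<le> m\<^sup>2" using q m by (simp add: abs_le_square_iff[symmetric])
  have "0 \<le> (\<bar>v - c\<bar> - 1)\<^sup>2" by simp
  then have "\<bar>v - c\<bar> \<le> 1 + (v - c)\<^sup>2"
    by (simp add: power2_eq_square algebra_simps) (smt (verit) zero_le_square)
  then have "\<bar>v\<bar> \<le> 1 + (v - c)\<^sup>2 + m" using c by linarith
  then have "\<bar>v * ?q\<bar> \<le> (1 + (v - c)\<^sup>2 + m) * m"
    unfolding abs_mult using q by (intro mult_mono) auto
  then have "\<bar>clip_potential qmin qmax v\<bar> \<le> (1 + (v - c)\<^sup>2 + m) * m + m\<^sup>2"
    using sq unfolding clip_potential_def by (smt (verit) zero_le_power2 field_sum_of_halves)
  also have "\<dots> \<le> (m + 2 * m\<^sup>2) * (1 + (v - c)\<^sup>2)"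
  proof -
    have "0 \<le> m\<^sup>2 * (v - c)\<^sup>2" by simp
    then show ?thesis by (simp add: distrib_left distrib_right power2_eq_square[of m])
  qed
  finally show ?thesis .
qed

text \<open>The Dirichlet energy of \<open>z\<close> for unit edge weights.\<close>

definition dispersion :: "('v::finite \<times> 'v) set \<Rightarrow> ('v \<Rightarrow> real) \<Rightarrow> real" where
  "dispersion E z = (\<Sum>(j, i)\<in>E. (z i - z j)\<^sup>2)"

lemma dispersion_nonneg: "dispersion E z \<ge> 0"
  by (auto simp: dispersion_def intro!: sum_nonneg)

text \<open>In edge form each summand is bounded by a potential difference minus half a squared
  clipped difference. The potential differences sum by parts to potential times imbalance, an error
  term; the squares survive with factor at least 1 because all edge weights are at least 1.\<close>

lemma drift_descent:
  fixes E :: "('v::finite \<times> 'v) set" and y :: "'v \<Rightarrow> real"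
  assumes A: "\<And>i j. (j, i) \<in> E \<Longrightarrow> 1 \<le> A i j" and c: "qmin \<le> c" "c \<le> qmax"
  defines "m \<equiv> \<bar>qmin\<bar> + \<bar>qmax\<bar>"
  shows "2 * (\<Sum>i\<in>UNIV. (y i - c) * drift E A (\<lambda>i. clip qmin qmax (y i)) i) \<le>
    2 * (m + 2 * m\<^sup>2) * (\<Sum>i\<in>UNIV. \<bar>imbalance E A i\<bar>) * (1 + (\<Sum>i\<in>UNIV. (y i - c)\<^sup>2))
    - dispersion E (\<lambda>i. clip qmin qmax (y i))"
proof -
  let ?c = "clip qmin qmax" and ?G = "clip_potential qmin qmax" and ?V = "\<Sum>i\<in>UNIV. (y i - c)\<^sup>2"
  have q: "qmin \<le> qmax" using c by simp
  have m: "m + 2 * m\<^sup>2 \<ge> 0" by (simp add: m_def)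
  have "(\<Sum>i\<in>UNIV. (y i - c) * drift E A (\<lambda>i. ?c (y i)) i) = (\<Sum>(j, i)\<in>E. A i j * (?c (y j) * (y i - y j)))"
    unfolding sum_mult_drift by (simp add: algebra_simps)
  also have "\<dots> \<le> (\<Sum>(j, i)\<in>E. A i j * (?G (y i) - ?G (y j)) - (?c (y i) - ?c (y j))\<^sup>2 / 2)"
  proof (rule sum_mono, clarify)
    fix j i assume e: "(j, i) \<in> E"
    have "A i j * (?c (y j) * (y i - y j)) \<le> A i j * (?G (y i) - ?G (y j) - (?c (y i) - ?c (y j))\<^sup>2 / 2)"
      using A[OF e] by (intro mult_left_mono clip_mult_diff_le q) auto
    also have "\<dots> = A i j * (?G (y i) - ?G (y j)) - A i j * ((?c (y i) - ?c (y j))\<^sup>2 / 2)"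
      by (rule right_diff_distrib)
    also have "\<dots> \<le> A i j * (?G (y i) - ?G (y j)) - 1 * ((?c (y i) - ?c (y j))\<^sup>2 / 2)"
      using A[OF e] by (intro diff_left_mono mult_right_mono) auto
    finally show "A i j * (?c (y j) * (y i - y j)) \<le>
      A i j * (?G (y i) - ?G (y j)) - (?c (y i) - ?c (y j))\<^sup>2 / 2" by simp
  qed
  also have "\<dots> = (\<Sum>i\<in>UNIV. ?G (y i) * imbalance E A i) - dispersion E (\<lambda>i. ?c (y i)) / 2"
    unfolding sum_mult_imbalance dispersion_def sum_divide_distrib
    by (simp add: sum_subtractf[symmetric] case_prod_beta')
  also have "(\<Sum>i\<in>UNIV. ?G (y i) * imbalance E A i) \<le>
    (\<Sum>i\<in>UNIV. (m + 2 * m\<^sup>2) * (1 + ?V) * \<bar>imbalance E A i\<bar>)"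
  proof (rule sum_mono)
    fix i
    have "\<bar>?G (y i)\<bar> \<le> (m + 2 * m\<^sup>2) * (1 + (y i - c)\<^sup>2)"
      unfolding m_def by (rule abs_clip_potential_le[OF c])
    also have "\<dots> \<le> (m + 2 * m\<^sup>2) * (1 + ?V)"
      by (intro mult_left_mono add_left_mono member_le_sum m) auto
    finally have "\<bar>?G (y i) * imbalance E A i\<bar> \<le> (m + 2 * m\<^sup>2) * (1 + ?V) * \<bar>imbalance E A i\<bar>"
      unfolding abs_mult by (rule mult_right_mono) simp
    then show "?G (y i) * imbalance E A i \<le> (m + 2 * m\<^sup>2) * (1 + ?V) * \<bar>imbalance E A i\<bar>" by linarith
  qed
  also have "\<dots> = (m + 2 * m\<^sup>2) * (1 + ?V) * (\<Sum>i\<in>UNIV. \<bar>imbalance E A i\<bar>)"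
    by (rule sum_distrib_left[symmetric])
  finally have "2 * (\<Sum>i\<in>UNIV. (y i - c) * drift E A (\<lambda>i. ?c (y i)) i) \<le>
    2 * ((m + 2 * m\<^sup>2) * (1 + ?V) * (\<Sum>i\<in>UNIV. \<bar>imbalance E A i\<bar>)) - dispersion E (\<lambda>i. ?c (y i))"
    by linarith
  then show ?thesis by (simp only: mult_ac)
qed

section \<open>Recovering the deviation from the dispersion of the clipped states\<close>

lemma spread_le_dispersion:
  fixes E :: "('v::finite \<times> 'v) set"
  assumes sc: "strongly_connected E"
  obtains C where "C > 0" "\<And>(z :: 'v \<Rightarrow> real) i j. \<bar>z i - z j\<bar> \<le> C * sqrt (dispersion E z)"
proof -
  \<comment> \<open>Along a path from \<open>i\<close> to \<open>j\<close> each edge contributes at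
    most the root of the dispersion, so the length of the path serves as constant.\<close>
  have "\<exists>c\<ge>0. \<forall>z :: 'v \<Rightarrow> real. \<bar>z i - z j\<bar> \<le> c * sqrt (dispersion E z)" for i j
  proof -
    have "(i, j) \<in> E\<^sup>*" using sc by (auto simp: strongly_connected_def)
    then show ?thesis
    proof (induction rule: rtrancl_induct)
      case (step j l)
      then obtain c where c: "c \<ge> 0" "\<And>z :: 'v \<Rightarrow> real. \<bar>z i - z j\<bar> \<le> c * sqrt (dispersion E z)"
        by blast
      have "\<bar>z i - z l\<bar> \<le> (c + 1) * sqrt (dispersion E z)" for z :: "'v \<Rightarrow> real"
      proof -
        have "(case (j, l) of (j, i) \<Rightarrow> (z i - z j)\<^sup>2) \<le> dispersion E z"
          unfolding dispersion_def by (rule member_le_sum) (use step in auto)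
        then have "\<bar>z l - z j\<bar> \<le> sqrt (dispersion E z)"
          by (simp add: real_le_rsqrt)
        then show ?thesis using c(2)[of z] by (simp add: algebra_simps)
      qed
      then show ?case using c(1) by (intro exI[of _ "c + 1"]) auto
    qed auto
  qed
  then obtain c where c: "\<And>i j. c i j \<ge> (0::real)"
    "\<And>i j (z :: 'v \<Rightarrow> real). \<bar>z i - z j\<bar> \<le> c i j * sqrt (dispersion E z)" by metis
  \<comment> \<open>The sum dominates every single \<open>c i j\<close>; the summand 1 makes the
    constant strictly positive.\<close>
  define C where "C = 1 + (\<Sum>i\<in>UNIV. \<Sum>j\<in>UNIV. c i j)"
  have le: "c i j \<le> C" for i j
  proof -
    have "c i j \<le> (\<Sum>j\<in>UNIV. c i j)" by (rule member_le_sum) (use c in auto)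
    also have "\<dots> \<le> (\<Sum>i\<in>UNIV. \<Sum>j\<in>UNIV. c i j)" by (rule member_le_sum) (use c in \<open>auto intro!: sum_nonneg\<close>)
    finally show ?thesis by (simp add: C_def)
  qed
  show thesis
  proof
    show "C > 0" unfolding C_def using c(1) by (intro add_pos_nonneg sum_nonneg) auto
    show "\<bar>z i - z j\<bar> \<le> C * sqrt (dispersion E z)" for z :: "'v \<Rightarrow> real" and i j
      by (rule order_trans[OF c(2) mult_right_mono[OF le]]) (simp add: dispersion_nonneg)
  qed
qed

text \<open>A one-sided bound suffices: whatever one coordinate has above the mean is missing from
  the others, each of which lacks at most \<open>s\<close>.\<close>

lemma abs_diff_mean_le:
  fixes y :: "'v::finite \<Rightarrow> real"
  assumes sum: "(\<Sum>i\<in>UNIV. y i) = real CARD('v) * c" and s: "\<And>i. c - s \<le> y i"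
  shows "\<bar>y i - c\<bar> \<le> real CARD('v) * s"
proof -
  have "real CARD('v) * c = y i + (\<Sum>j\<in>UNIV - {i}. y j)"
    unfolding sum[symmetric] by (subst sum.remove[of _ i]) auto
  moreover have "(\<Sum>j\<in>UNIV - {i}. y j) \<ge> (\<Sum>j\<in>UNIV - {i}. c - s)" by (rule sum_mono) (rule s)
  moreover have "(\<Sum>j\<in>UNIV - {i}. c - s) = (real CARD('v) - 1) * (c - s)"
    by (simp add: card_Diff_singleton of_nat_diff Suc_leI)
  moreover have "s \<ge> 0"
  proof -
    have "real CARD('v) * (c - s) \<le> real CARD('v) * c"
      using sum_mono[of UNIV "\<lambda>_. c - s" y] s sum by simp
    then show ?thesis by simp
  qed
  moreover have "s \<le> real CARD('v) * s"
    using \<open>s \<ge> 0\<close> by (intro mult_left_le_one_le[THEN order_trans] mult_le_cancel_right1[THEN iffD2]) (auto simp: Suc_leI)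
  ultimately show ?thesis using s[of i] by (auto simp: algebra_simps abs_le_iff)
qed

text \<open>Clipped values with spread below \<open>qmax - qmin\<close> cannot touch both ends, so
  clipping is inactive on one side. Comparison with a node on the other side of the mean then gives
  a one-sided bound on the unclipped states.\<close>

lemma abs_diff_mean_le_clip_spread:
  fixes y :: "'v::finite \<Rightarrow> real"
  assumes sum: "(\<Sum>i\<in>UNIV. y i) = real CARD('v) * c" and c: "qmin \<le> c" "c \<le> qmax"
    and s: "\<And>i j. \<bar>clip qmin qmax (y i) - clip qmin qmax (y j)\<bar> \<le> s" and lt: "s < qmax - qmin"
  shows "\<bar>y i - c\<bar> \<le> real CARD('v) * s"
proof -
  have lower: "\<exists>i. z i \<le> c'" "\<exists>i. z i \<ge> c'" if "(\<Sum>i\<in>UNIV. z i) = real CARD('v) * c'" for z :: "'v \<Rightarrow> real" and c'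
  proof -
    show "\<exists>i. z i \<le> c'"
    proof (rule ccontr)
      assume "\<not> ?thesis"
      then have "(\<Sum>i\<in>(UNIV::'v set). c') < (\<Sum>i\<in>UNIV. z i)" by (intro sum_strict_mono) (auto simp: not_le)
      then show False using that by simp
    qed
    show "\<exists>i. z i \<ge> c'"
    proof (rule ccontr)
      assume "\<not> ?thesis"
      then have "(\<Sum>i\<in>UNIV. z i) < (\<Sum>i\<in>(UNIV::'v set). c')" by (intro sum_strict_mono) (auto simp: not_le)
      then show False using that by simp
    qed
  qed
  obtain a b where ab: "y a \<le> c" "y b \<ge> c" using lower[OF sum] by blast
  have "(\<forall>i. qmin < y i) \<or> (\<forall>i. y i < qmax)"
  proof (rule ccontr)
    assume "\<not> ?thesis"
    then obtain i j where "y i \<le> qmin" "y j \<ge> qmax" by (auto simp: not_less)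
    then show False using s[of i j] lt c by (auto simp: clip_def)
  qed
  then show ?thesis
  proof
    assume lo: "\<forall>i. qmin < y i"
    have "c - s \<le> y j" for j
      using spec[OF lo, of j] ab s[of b j] c by (auto simp: clip_def min_def max_def split: if_splits)
    then show ?thesis by (rule abs_diff_mean_le[OF sum])
  next
    assume hi: "\<forall>i. y i < qmax"
    \<comment> \<open>The upper bound \<open>y j \<le> c + s\<close>, negated so that the one-sided
      lemma applies to the reflected states.\<close>
    have "- c - s \<le> - y j" for j
      using spec[OF hi, of j] ab s[of j a] c by (auto simp: clip_def min_def max_def split: if_splits)
    then have "\<bar>- y i - (- c)\<bar> \<le> real CARD('v) * s"
      by (intro abs_diff_mean_le) (use sum in \<open>auto simp: sum_negf\<close>)
    then show ?thesis by simp
  qed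
qed

text \<open>Away from small dispersion the deviation is controlled only through its own square, at an
  arbitrary level \<open>R\<close>.\<close>

lemma deviation_le_dispersion:
  fixes E :: "('v::finite \<times> 'v) set"
  assumes sc: "strongly_connected E" and q: "qmin < qmax" and c: "qmin \<le> c" "c \<le> qmax"
  obtains K L where "K \<ge> 0" "L \<ge> 0"
    "\<And>(y :: 'v \<Rightarrow> real) R. (\<Sum>i\<in>UNIV. y i) = real CARD('v) * c \<Longrightarrow> R > 0 \<Longrightarrow>
      (\<Sum>i\<in>UNIV. (y i - c)\<^sup>2) \<le> (K + L * R) * dispersion E (\<lambda>i. clip qmin qmax (y i))
        + (\<Sum>i\<in>UNIV. (y i - c)\<^sup>2)\<^sup>2 / R"
proof -
  obtain C where C: "C > 0" "\<And>(z :: 'v \<Rightarrow> real) i j. \<bar>z i - z j\<bar> \<le> C * sqrt (dispersion E z)"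
    using spread_le_dispersion[OF sc] by blast
  define K where "K = real CARD('v) * (real CARD('v) * C)\<^sup>2"
  define L where "L = (C / (qmax - qmin))\<^sup>2"
  show thesis
  proof
    show "K \<ge> 0" "L \<ge> 0" by (auto simp: K_def L_def)
    fix y :: "'v \<Rightarrow> real" and R :: real
    assume sum: "(\<Sum>i\<in>UNIV. y i) = real CARD('v) * c" and R: "R > 0"
    let ?V = "\<Sum>i\<in>UNIV. (y i - c)\<^sup>2" and ?Q = "dispersion E (\<lambda>i. clip qmin qmax (y i))"
    have Q: "?Q \<ge> 0" by (rule dispersion_nonneg)
    have V: "?V \<ge> 0" by (intro sum_nonneg) auto
    show "?V \<le> (K + L * R) * ?Q + ?V\<^sup>2 / R"
    \<comment> \<open>Below this threshold the clipped spread controls the deviation. Otherwise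
      \<open>L * ?Q \<ge> 1\<close>, so the \<open>L * R\<close> term covers
      \<open>?V \<le> R\<close>, while for larger \<open>?V\<close> the quotient
      \<open>?V\<^sup>2 / R\<close> already exceeds \<open>?V\<close>.\<close>
    proof (cases "C * sqrt ?Q < qmax - qmin")
      case True
      have "(y i - c)\<^sup>2 \<le> (real CARD('v) * C)\<^sup>2 * ?Q" for i
      proof -
        have "\<bar>y i - c\<bar> \<le> real CARD('v) * (C * sqrt ?Q)"
          by (rule abs_diff_mean_le_clip_spread[OF sum c _ True]) (rule C(2))
        then have "(y i - c)\<^sup>2 \<le> (real CARD('v) * (C * sqrt ?Q))\<^sup>2"
          using power_mono[of "\<bar>y i - c\<bar>" _ 2] by simp
        then show ?thesis using Q by (simp add: power_mult_distrib algebra_simps)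
      qed
      then have "?V \<le> (\<Sum>i\<in>(UNIV::'v set). (real CARD('v) * C)\<^sup>2 * ?Q)" by (rule sum_mono)
      also have "\<dots> = K * ?Q" by (simp add: K_def)
      finally have "?V \<le> K * ?Q" .
      moreover have "0 \<le> L * R * ?Q" "0 \<le> ?V\<^sup>2 / R" using Q R by (auto simp: L_def)
      ultimately show ?thesis by (simp add: algebra_simps)
    next
      case False
      then have "(qmax - qmin)\<^sup>2 \<le> (C * sqrt ?Q)\<^sup>2" using q by (intro power_mono) auto
      then have LQ: "1 \<le> L * ?Q" using q Q by (simp add: L_def power_divide power_mult_distrib)
      have "?V \<le> L * R * ?Q + ?V\<^sup>2 / R"
      proof (cases "?V \<le> R")
        case True
        have "R * 1 \<le> R * (L * ?Q)" using LQ R by (intro mult_left_mono) auto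
        then have "?V \<le> R * (L * ?Q)" using True by simp
        moreover have "0 \<le> ?V\<^sup>2 / R" using R by simp
        ultimately show ?thesis by (simp add: algebra_simps)
      next
        case False
        then have "?V * R \<le> ?V * ?V" using V by (intro mult_left_mono) auto
        then have "?V \<le> ?V\<^sup>2 / R" using R by (simp add: field_simps power2_eq_square)
        moreover have "0 \<le> L * R * ?Q" using Q R by (auto simp: L_def)
        ultimately show ?thesis by simp
      qed
      moreover have "0 \<le> K * ?Q" using Q by (simp add: K_def)
      ultimately show ?thesis by (simp add: algebra_simps)
    qed
  qed
qed

section \<open>Supermartingales and independent samples\<close>

text \<open>Ville's inequality. The supermartingale property is tested against the events that the
  level \<open>e\<close> has not been reached yet, so no conditional expectations appear.\<close>

lemma (in prob_space) maximal_inequality: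
  fixes Z :: "nat \<Rightarrow> 'a \<Rightarrow> real"
  assumes int: "\<And>k. integrable M (Z k)" and nonneg: "\<And>k \<omega>. 0 \<le> Z k \<omega>" and pos: "0 < e"
    and super: "\<And>k. m \<le> k \<Longrightarrow>
      (\<integral>\<omega>. indicator {\<omega>. \<forall>l\<in>{m..k}. Z l \<omega> < e} \<omega> * Z (Suc k) \<omega> \<partial>M) \<le>
      (\<integral>\<omega>. indicator {\<omega>. \<forall>l\<in>{m..k}. Z l \<omega> < e} \<omega> * Z k \<omega> \<partial>M)"
  shows "prob {\<omega> \<in> space M. \<exists>k\<ge>m. e \<le> Z k \<omega>} \<le> expectation (Z m) / e"
proof -
  have [measurable]: "Z k \<in> borel_measurable M" for k using int by auto
  \<comment> \<open>The window is half-open: \<open>G n\<close> leaves \<open>Z n\<close> itself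
    untested, so a crossing at time \<open>n\<close> is counted in the passage to
    \<open>Suc n\<close>.\<close>
  define G where "G n = {\<omega>. \<forall>l\<in>{m..<n}. Z l \<omega> < e}" for n
  define H where "H n = {\<omega> \<in> space M. \<not> (\<forall>l\<in>{m..<n}. Z l \<omega> < e)}" for n
  have [measurable]: "H n \<in> sets M" for n unfolding H_def by measurable
  have G_meas [measurable]: "(\<lambda>\<omega>. indicator (G n) \<omega> :: real) \<in> borel_measurable M" for n
    unfolding G_def indicator_def mem_Collect_eq by measurable
  have intG: "integrable M (\<lambda>\<omega>. indicator (G n) \<omega> * Z k \<omega>)" for n k
  proof (rule Bochner_Integration.integrable_bound[OF int[of k]])
    show "AE \<omega> in M. norm (indicator (G n) \<omega> * Z k \<omega>) \<le> norm (Z k \<omega>)"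
      by (auto simp: indicator_def)
  qed (intro borel_measurable_times G_meas, measurable)
  have intH: "integrable M (\<lambda>\<omega>. e * indicator (H n) \<omega>)" for n
    by (intro integrable_mult_right integrable_real_indicator) (simp_all add: emeasure_eq_measure)
  have split: "e * prob (H n) + expectation (\<lambda>\<omega>. indicator (G j) \<omega> * Z k \<omega>) =
    expectation (\<lambda>\<omega>. e * indicator (H n) \<omega> + indicator (G j) \<omega> * Z k \<omega>)" for n j k
    by (subst Bochner_Integration.integral_add[OF intH intG]) simp
  \<comment> \<open>Stopping at the first crossing: paths that have crossed are charged
    \<open>e\<close>, the others their current value. A path crossing now has value at least
    \<open>e\<close>, so the recharge does not raise the total.\<close>
  have step: "e * prob (H n) + expectation (\<lambda>\<omega>. indicator (G n) \<omega> * Z n \<omega>) \<le> expectation (Z m)"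
    if "m \<le> n" for n
    using that
  proof (induction rule: dec_induct)
    case base
    then show ?case by (simp add: G_def H_def)
  next
    case (step n)
    have GS: "G (Suc n) = {\<omega>. \<forall>l\<in>{m..n}. Z l \<omega> < e}" by (simp add: G_def atLeastLessThanSuc_atLeastAtMost)
    have HS: "H (Suc n) = {\<omega> \<in> space M. \<omega> \<notin> G (Suc n)}" "H n = {\<omega> \<in> space M. \<omega> \<notin> G n}"
      by (auto simp: H_def G_def)
    have "e * prob (H (Suc n)) + expectation (\<lambda>\<omega>. indicator (G (Suc n)) \<omega> * Z (Suc n) \<omega>)
      \<le> e * prob (H (Suc n)) + expectation (\<lambda>\<omega>. indicator (G (Suc n)) \<omega> * Z n \<omega>)"
      unfolding GS using super[of n] step by simp
    also have "\<dots> = expectation (\<lambda>\<omega>. e * indicator (H (Suc n)) \<omega> + indicator (G (Suc n)) \<omega> * Z n \<omega>)"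
      by (rule split)
    also have "\<dots> \<le> expectation (\<lambda>\<omega>. e * indicator (H n) \<omega> + indicator (G n) \<omega> * Z n \<omega>)"
    proof (rule integral_mono)
      show "e * indicator (H (Suc n)) \<omega> + indicator (G (Suc n)) \<omega> * Z n \<omega>
        \<le> e * indicator (H n) \<omega> + indicator (G n) \<omega> * Z n \<omega>" if "\<omega> \<in> space M" for \<omega>
      proof -
        have "\<omega> \<in> G (Suc n) \<longleftrightarrow> \<omega> \<in> G n \<and> Z n \<omega> < e" using step.hyps by (auto simp: G_def less_Suc_eq)
        then show ?thesis using that unfolding HS by (auto simp: indicator_def)
      qed
    qed (intro Bochner_Integration.integrable_add intH intG)+
    also have "\<dots> = e * prob (H n) + expectation (\<lambda>\<omega>. indicator (G n) \<omega> * Z n \<omega>)"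
      by (rule split[symmetric])
    finally show ?case using step.IH by linarith
  qed
  have lim: "(\<lambda>n. prob (H n)) \<longlonglongrightarrow> prob (\<Union>n. H n)"
    by (rule finite_Lim_measure_incseq) (auto simp: incseq_def H_def)
  have "prob (H n) \<le> expectation (Z m) / e" if "m \<le> n" for n
  proof -
    have "0 \<le> expectation (\<lambda>\<omega>. indicator (G n) \<omega> * Z n \<omega>)"
      using nonneg by (intro Bochner_Integration.integral_nonneg) auto
    then show ?thesis using step[OF that] pos by (simp add: field_simps)
  qed
  then have "prob (\<Union>n. H n) \<le> expectation (Z m) / e"
    by (intro LIMSEQ_le_const2[OF lim]) blast
  also have "(\<Union>n. H n) = {\<omega> \<in> space M. \<exists>k\<ge>m. e \<le> Z k \<omega>}"
    by (auto simp: H_def not_less) (metis atLeastLessThan_iff lessI)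
  finally show ?thesis .
qed

text \<open>Exceeding \<open>e\<close> at arbitrarily late times has probability at most the mean of
  \<open>Z m\<close> over \<open>e\<close> for every \<open>m\<close>, hence zero. Countably many
  levels \<open>1 / Suc n\<close> give convergence.\<close>

lemma (in prob_space) AE_tendsto_0:
  fixes Z :: "nat \<Rightarrow> 'a \<Rightarrow> real"
  assumes int: "\<And>k. integrable M (Z k)" and nonneg: "\<And>k \<omega>. 0 \<le> Z k \<omega>"
    and super: "\<And>m k e. m \<le> k \<Longrightarrow>
      (\<integral>\<omega>. indicator {\<omega>. \<forall>l\<in>{m..k}. Z l \<omega> < e} \<omega> * Z (Suc k) \<omega> \<partial>M) \<le>
      (\<integral>\<omega>. indicator {\<omega>. \<forall>l\<in>{m..k}. Z l \<omega> < e} \<omega> * Z k \<omega> \<partial>M)"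
    and lim: "(\<lambda>k. expectation (Z k)) \<longlonglongrightarrow> 0"
  shows "AE \<omega> in M. (\<lambda>k. Z k \<omega>) \<longlonglongrightarrow> 0"
proof -
  have [measurable]: "Z k \<in> borel_measurable M" for k using int by auto
  have "AE \<omega> in M. \<exists>m. \<forall>k\<ge>m. Z k \<omega> < e" if e: "e > 0" for e
  proof -
    let ?B = "{\<omega> \<in> space M. \<forall>m. \<exists>k\<ge>m. e \<le> Z k \<omega>}"
    have [measurable]: "?B \<in> sets M" by measurable
    have le: "prob ?B \<le> expectation (Z m) / e" for m
    proof -
      have "prob ?B \<le> prob {\<omega> \<in> space M. \<exists>k\<ge>m. e \<le> Z k \<omega>}"
        by (intro finite_measure_mono) (auto, measurable)
      also have "\<dots> \<le> expectation (Z m) / e"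
        by (rule maximal_inequality[OF int nonneg e super])
      finally show ?thesis .
    qed
    have "(\<lambda>m. expectation (Z m) / e) \<longlonglongrightarrow> 0 / e"
      by (rule tendsto_divide[OF lim tendsto_const]) (use e in auto)
    then have "prob ?B \<le> 0 / e"
      by (rule LIMSEQ_le_const) (use le in blast)
    then have "prob ?B = 0" using measure_nonneg[of M ?B] by simp
    then have "AE \<omega> in M. \<omega> \<notin> ?B" by (subst (asm) prob_eq_0) auto
    then show ?thesis using AE_space
    proof eventually_elim
      case (elim \<omega>)
      then obtain m where "\<And>k. k \<ge> m \<Longrightarrow> \<not> e \<le> Z k \<omega>" by blast
      then show ?case by (auto simp: not_le)
    qed
  qed
  then have "AE \<omega> in M. \<forall>n. \<exists>m. \<forall>k\<ge>m. Z k \<omega> < 1 / real (Suc n)"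
    unfolding AE_all_countable by simp
  then show ?thesis
  proof eventually_elim
    case (elim \<omega>)
    show ?case
    proof (rule LIMSEQ_I)
      fix r :: real assume "0 < r"
      then obtain n where n: "1 / real (Suc n) < r" using nat_approx_posE by blast
      obtain m where "\<And>k. k \<ge> m \<Longrightarrow> Z k \<omega> < 1 / real (Suc n)" using elim by blast
      then have "norm (Z k \<omega> - 0) < r" if "k \<ge> m" for k
        using n nonneg[of k \<omega>] that by fastforce
      then show "\<exists>no. \<forall>k\<ge>no. norm (Z k \<omega> - 0) < r" by blast
    qed
  qed
qed

section \<open>The sample space, resampling of one coordinate and unbiased quantization\<close>

abbreviation (input) unif :: "real measure" where "unif \<equiv> uniform_measure lborel {0..1}"

interpretation unif: prob_space unif
  by (rule prob_space_uniform_measure) auto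

definition samples :: "(nat \<times> 'v \<Rightarrow> real) measure" where
  "samples = PiM UNIV (\<lambda>_. unif)"

interpretation samples: prob_space samples
  unfolding samples_def by (rule prob_space_PiM) (rule unif.prob_space_axioms)

lemma space_samples [simp]: "space samples = UNIV"
  by (simp add: samples_def space_PiM)

lemma measure_samples_UNIV [simp]: "measure samples UNIV = 1"
  using samples.prob_space by simp

lemma measurable_sample [measurable]: "(\<lambda>\<omega>. \<omega> t) \<in> borel_measurable samples"
proof -
  have "(\<lambda>\<omega>. \<omega> t) \<in> measurable samples unif"
    unfolding samples_def by (rule measurable_component_singleton) simp
  then show ?thesis by (simp cong: measurable_cong_sets)
qed

text \<open>Independence enters in this form: replacing one coordinate by a fresh uniform sample
  preserves the law.\<close>

lemma distr_resample: "distr (unif \<Otimes>\<^sub>M samples) samples (\<lambda>(u, s). s(t := u)) = samples"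
  using distr_pair_PiM_eq_PiM[of UNIV "\<lambda>_. unif" t] unif.prob_space_axioms
  by (simp add: samples_def)

lemma measurable_resample: "(\<lambda>(u, s). s(t := u)) \<in> measurable (unif \<Otimes>\<^sub>M samples) samples"
  unfolding samples_def
proof (rule measurable_PiM_single')
  show "(\<lambda>x. (case x of (u, s) \<Rightarrow> s(t := u)) i) \<in> unif \<Otimes>\<^sub>M Pi\<^sub>M UNIV (\<lambda>_. unif) \<rightarrow>\<^sub>M unif" for i
    by (cases "i = t") (simp_all add: case_prod_beta')
qed (simp add: space_PiM)

lemma integral_threshold:
  assumes p: "0 \<le> p" "p \<le> 1"
  shows "(\<integral>u. (if u < p then 1 else 0) \<partial>unif) = p"
proof -
  have "(\<integral>u. (if u < p then 1 else 0) \<partial>unif) = (\<integral>u. indicator {..<p} u \<partial>unif)"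
    by (rule Bochner_Integration.integral_cong) (auto simp: indicator_def)
  also have "\<dots> = measure unif {..<p}" by simp
  also have "\<dots> = measure lborel ({0..1} \<inter> {..<p})" by simp
  also have "{0..1} \<inter> {..<p} = {0..<p}" using p by auto
  finally show ?thesis using p by simp
qed

text \<open>Coordinate \<open>t\<close> is redrawn, which neither \<open>h\<close> nor
  \<open>p\<close> notices, and by Fubini it is integrated first.\<close>

lemma integral_threshold_indep:
  fixes h p :: "(nat \<times> 'v \<Rightarrow> real) \<Rightarrow> real"
  assumes h [measurable]: "h \<in> borel_measurable samples" and p [measurable]: "p \<in> borel_measurable samples"
    and h_indep: "\<And>s u. h (s(t := u)) = h s" and p_indep: "\<And>s u. p (s(t := u)) = p s"
    and B: "\<And>s. \<bar>h s\<bar> \<le> B" and p01: "\<And>s. 0 \<le> p s" "\<And>s. p s \<le> 1"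
  shows "(\<integral>s. h s * (if s t < p s then 1 else 0) \<partial>samples) = (\<integral>s. h s * p s \<partial>samples)"
proof -
  interpret pair_prob_space unif samples ..
  have "(\<integral>s. h s * (if s t < p s then 1 else 0) \<partial>samples) =
    (\<integral>s. h s * (if s t < p s then 1 else 0) \<partial>distr (unif \<Otimes>\<^sub>M samples) samples (\<lambda>(u, s). s(t := u)))"
    by (simp add: distr_resample)
  also have "\<dots> = (\<integral>(u, s). h s * (if u < p s then 1 else 0) \<partial>(unif \<Otimes>\<^sub>M samples))"
    by (subst integral_distr[OF measurable_resample]) (auto simp: h_indep p_indep case_prod_beta')
  also have "\<dots> = (\<integral>s. \<integral>u. h s * (if u < p s then 1 else 0) \<partial>unif \<partial>samples)"
  proof (rule integral_snd[symmetric])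
    show "integrable (unif \<Otimes>\<^sub>M samples) (\<lambda>(u, s). h s * (if u < p s then 1 else 0))"
    proof (rule P.integrable_const_bound[of _ B])
      show "AE x in unif \<Otimes>\<^sub>M samples. norm (case x of (u, s) \<Rightarrow> h s * (if u < p s then 1 else 0)) \<le> B"
        using B order_trans[OF abs_ge_zero B] by (intro AE_I2) (auto split: prod.split)
    qed measurable
  qed
  also have "\<dots> = (\<integral>s. h s * p s \<partial>samples)"
    using p01 by (simp add: integral_threshold)
  finally show ?thesis .
qed

text \<open>Bounded measurable functions of the samples drawn before time \<open>k\<close>. Independence of the later samples
  is encoded as invariance under changing a single later coordinate.\<close>

definition past :: "nat \<Rightarrow> ((nat \<times> 'v \<Rightarrow> real) \<Rightarrow> real) \<Rightarrow> bool" where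
  "past k h \<longleftrightarrow> h \<in> borel_measurable samples \<and> (\<forall>s t u. k \<le> fst t \<longrightarrow> h (s(t := u)) = h s)
     \<and> (\<exists>B. \<forall>s. \<bar>h s\<bar> \<le> B)"

lemma past_const: "past k (\<lambda>_. c)"
  by (auto simp: past_def)

lemma past_mono: "past k h \<Longrightarrow> k \<le> l \<Longrightarrow> past l h"
  by (auto simp: past_def)

lemma past_add: assumes "past k f" "past k g" shows "past k (\<lambda>s. f s + g s)"
proof -
  obtain B C where "\<And>s. \<bar>f s\<bar> \<le> B" "\<And>s. \<bar>g s\<bar> \<le> C" using assms by (auto simp: past_def)
  then have "\<bar>f s + g s\<bar> \<le> B + C" for s by (rule order_trans[OF abs_triangle_ineq add_mono])
  then show ?thesis using assms by (auto simp: past_def)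
qed

lemma past_mult: assumes "past k f" "past k g" shows "past k (\<lambda>s. f s * g s)"
proof -
  obtain B C where B: "\<And>s. \<bar>f s\<bar> \<le> B" "\<And>s. \<bar>g s\<bar> \<le> C" using assms by (auto simp: past_def)
  have "\<bar>f s * g s\<bar> \<le> B * C" for s
    unfolding abs_mult by (intro mult_mono B abs_ge_zero order_trans[OF abs_ge_zero B(1)])
  then show ?thesis using assms by (auto simp: past_def)
qed

lemma past_diff: "past k f \<Longrightarrow> past k g \<Longrightarrow> past k (\<lambda>s. f s - g s)"
  using past_add[of k f "\<lambda>s. -1 * g s"] past_mult[OF past_const, of k g "-1"] by simp

lemma past_power2: "past k f \<Longrightarrow> past k (\<lambda>s. (f s)\<^sup>2)"
  unfolding power2_eq_square by (rule past_mult)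

lemma past_sum: "(\<And>i. i \<in> I \<Longrightarrow> past k (f i)) \<Longrightarrow> past k (\<lambda>s. \<Sum>i\<in>I. f i s)"
  by (induction I rule: infinite_finite_induct) (auto intro: past_const past_add)

lemma past_clip: assumes "past k f" "qmin \<le> qmax" shows "past k (\<lambda>s. clip qmin qmax (f s))"
proof -
  have [measurable]: "f \<in> borel_measurable samples" using assms by (auto simp: past_def)
  have "(\<lambda>s. clip qmin qmax (f s)) \<in> borel_measurable samples" unfolding clip_def by measurable
  moreover have "\<exists>B. \<forall>s. \<bar>clip qmin qmax (f s)\<bar> \<le> B" using abs_clip_le[OF assms(2)] by blast
  ultimately show ?thesis using assms(1) by (auto simp: past_def)
qed

lemma past_quant:
  assumes "past k f" "qmin \<le> qmax"
  shows "past (Suc k) (\<lambda>s. quant qmin qmax (f s) (s (k, j)))"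
proof -
  have [measurable]: "f \<in> borel_measurable samples" using assms by (auto simp: past_def)
  have "(\<lambda>s. quant qmin qmax (f s) (s (k, j))) \<in> borel_measurable samples"
    unfolding quant_def clip_def by measurable
  moreover have "\<bar>quant qmin qmax (f s) (s (k, j))\<bar> \<le> \<bar>qmin\<bar> + \<bar>qmax\<bar>" for s
    by (auto simp: quant_def)
  ultimately show ?thesis using assms(1) by (auto simp: past_def)
qed

text \<open>These indicators of not having reached a level are the test functions that the maximal
  inequality asks for.\<close>

lemma past_indicator_less:
  assumes "finite I" "\<And>l. l \<in> I \<Longrightarrow> past k (f l)"
  shows "past k (indicator {s. \<forall>l\<in>I. f l s < e})"
proof -
  have "{s \<in> space samples. f l s < e} \<in> sets samples" if "l \<in> I" for l
  proof -
    have [measurable]: "f l \<in> borel_measurable samples" using assms(2)[OF that] by (auto simp: past_def)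
    show ?thesis by measurable
  qed
  then have "{s \<in> space samples. \<forall>l\<in>I. f l s < e} \<in> sets samples"
    using assms(1) by (rule sets.sets_Collect_finite_All)
  then have "indicator {s. \<forall>l\<in>I. f l s < e} \<in> borel_measurable samples"
    by (intro borel_measurable_indicator) simp
  moreover have "\<bar>indicator {s. \<forall>l\<in>I. f l s < e} s\<bar> \<le> (1::real)" for s by (simp add: indicator_def)
  ultimately show ?thesis using assms(2) unfolding past_def by (auto simp: indicator_def)
qed

lemma past_integrable: assumes "past k h" shows "integrable samples h"
proof -
  obtain B where "\<And>s. \<bar>h s\<bar> \<le> B" using assms by (auto simp: past_def)
  then show ?thesis
    using assms by (intro samples.integrable_const_bound[of _ B]) (auto simp: past_def)
qed

text \<open>Unbiasedness of the quantizer given the past, with \<open>h\<close> as test function in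
  place of conditioning. The quantizer is \<open>qmin\<close> plus \<open>qmax - qmin\<close> times
  a threshold indicator.\<close>

lemma integral_quant:
  assumes h: "past k h" and y: "past k y" and q: "qmin < qmax"
  shows "(\<integral>s. h s * quant qmin qmax (y s) (s (k, j)) \<partial>samples) =
    (\<integral>s. h s * clip qmin qmax (y s) \<partial>samples)"
proof -
  let ?c = "\<lambda>s. clip qmin qmax (y s)"
  let ?p = "\<lambda>s. (?c s - qmin) / (qmax - qmin)"
  note [measurable] = measurable_sample
  have hm [measurable]: "h \<in> borel_measurable samples" and [measurable]: "y \<in> borel_measurable samples"
    using h y by (auto simp: past_def)
  have pm [measurable]: "?p \<in> borel_measurable samples" unfolding clip_def by measurable
  obtain B where B: "\<And>s. \<bar>h s\<bar> \<le> B" using h by (auto simp: past_def)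
  have p01: "0 \<le> ?p s" "?p s \<le> 1" for s
    using clip_bounds[of qmin qmax "y s"] q by (auto simp: divide_simps)
  have thr: "(\<integral>s. h s * (if s (k, j) < ?p s then 1 else 0) \<partial>samples) = (\<integral>s. h s * ?p s \<partial>samples)"
    by (rule integral_threshold_indep[where B = B])
      (use h y B p01 in \<open>auto simp: past_def simp del: divide_le_eq_1 le_divide_eq\<close>)
  have int1: "integrable samples (\<lambda>s. h s * (if s (k, j) < ?p s then 1 else 0))"
    by (rule samples.integrable_const_bound[of _ B])
      (use B order_trans[OF abs_ge_zero B] in auto)
  have int2: "integrable samples (\<lambda>s. h s * ?p s)"
  proof (rule samples.integrable_const_bound[of _ B])
    have "\<bar>?p s\<bar> \<le> 1" for s unfolding abs_of_nonneg[OF p01(1)] by (rule p01)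
    then have "\<bar>h s\<bar> * \<bar>?p s\<bar> \<le> B * 1" for s
      by (intro mult_mono B abs_ge_zero order_trans[OF abs_ge_zero B])
    then show "AE s in samples. norm (h s * ?p s) \<le> B" by (intro AE_I2) (simp only: real_norm_def abs_mult mult_1_right)
  qed measurable
  note inth = past_integrable[OF h]
  have "(\<integral>s. h s * quant qmin qmax (y s) (s (k, j)) \<partial>samples) =
    (\<integral>s. qmin * h s + (qmax - qmin) * (h s * (if s (k, j) < ?p s then 1 else 0)) \<partial>samples)"
    by (rule Bochner_Integration.integral_cong) (auto simp: quant_def algebra_simps)
  also have "\<dots> = qmin * (\<integral>s. h s \<partial>samples)
      + (qmax - qmin) * (\<integral>s. h s * (if s (k, j) < ?p s then 1 else 0) \<partial>samples)"
    using int1 inth by (subst Bochner_Integration.integral_add) auto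
  also have "\<dots> = (\<integral>s. qmin * h s + (qmax - qmin) * (h s * ?p s) \<partial>samples)"
    unfolding thr Bochner_Integration.integral_add[OF integrable_mult_right[OF inth] integrable_mult_right[OF int2]]
    by (simp only: integral_mult_right_zero)
  also have "\<dots> = (\<integral>s. h s * ?c s \<partial>samples)"
    by (rule Bochner_Integration.integral_cong) (use q in \<open>auto simp: field_simps\<close>)
  finally show ?thesis .
qed

section \<open>Convergence of the states\<close>

lemma prod_1_plus_bounds:
  fixes a :: "nat \<Rightarrow> real"
  assumes a: "\<And>k. 0 \<le> a k" and sum: "summable a"
  shows "1 \<le> (\<Prod>l<k. 1 + a l)" "(\<Prod>l<k. 1 + a l) \<le> exp (suminf a)"
proof -
  show "1 \<le> (\<Prod>l<k. 1 + a l)" using a by (intro prod_ge_1) auto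
  have "(\<Prod>l<k. 1 + a l) \<le> (\<Prod>l<k. exp (a l))"
    using a by (intro prod_mono) (auto intro: exp_ge_add_one_self add_nonneg_nonneg)
  also have "\<dots> = exp (\<Sum>l<k. a l)" by (simp add: exp_sum)
  also have "\<dots> \<le> exp (suminf a)" using a sum by (simp add: sum_le_suminf)
  finally show "(\<Prod>l<k. 1 + a l) \<le> exp (suminf a)" .
qed

lemma discrete_gronwall:
  fixes a e :: "nat \<Rightarrow> real"
  assumes a: "\<And>k. 0 \<le> a k" and sum: "summable a" and e: "0 \<le> e 0"
    and step: "\<And>k. e (Suc k) \<le> (1 + a k) * e k"
  shows "e k \<le> exp (suminf a) * e 0"
proof -
  have "e k \<le> (\<Prod>l<k. 1 + a l) * e 0"
  proof (induction k)
    case (Suc k)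
    have "e (Suc k) \<le> (1 + a k) * ((\<Prod>l<k. 1 + a l) * e 0)"
      using step[of k] mult_left_mono[OF Suc, of "1 + a k"] a[of k] by linarith
    then show ?case by (simp add: mult_ac)
  qed simp
  also have "\<dots> \<le> exp (suminf a) * e 0"
    by (intro mult_right_mono prod_1_plus_bounds a sum e)
  finally show ?thesis .
qed

text \<open>Otherwise \<open>g\<close> stays above \<open>e\<close> from \<open>m\<close> on, and
  \<open>a\<close> is dominated by the summable \<open>a k * g k / e\<close>.\<close>

lemma not_summable_weighted_small:
  fixes a g :: "nat \<Rightarrow> real"
  assumes a: "\<And>k. 0 \<le> a k" "\<not> summable a" and sum: "summable (\<lambda>k. a k * g k)" and e: "0 < e"
  obtains k where "m \<le> k" "g k < e"
proof (rule ccontr)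
  assume "\<not> thesis"
  then have ge: "e \<le> g k" if "m \<le> k" for k using that \<open>\<And>k. m \<le> k \<Longrightarrow> g k < e \<Longrightarrow> thesis\<close> by force
  have "summable a"
  proof (rule summable_comparison_test)
    show "summable (\<lambda>k. a k * g k / e)" using sum by (rule summable_divide)
    have "norm (a k) \<le> a k * g k / e" if "m \<le> k" for k
      using mult_left_mono[OF ge[OF that] a(1)[of k]] a(1)[of k] e by (simp add: field_simps)
    then show "\<exists>N. \<forall>k\<ge>N. norm (a k) \<le> a k * g k / e" by blast
  qed
  then show False using a(2) by simp
qed

section \<open>The random states: energy inequality, moments and convergence\<close>

locale quantized_consensus =
  fixes E :: "('v::finite \<times> 'v) set" and \<gamma> \<alpha> :: "nat \<Rightarrow> real" and qmin qmax c :: real and y0 :: "'v \<Rightarrow> real"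
  assumes sc: "strongly_connected E"
    and q: "qmin < qmax" and c: "qmin \<le> c" "c \<le> qmax"
    and mean: "(\<Sum>i\<in>UNIV. y0 i) = real CARD('v) * c"
    and gamma: "\<And>k. 1 / (real k + 1) \<le> \<gamma> k" "\<And>k. \<gamma> k \<le> 2 / (real k + 1)"
    and alpha_pos: "\<And>k. 0 < \<alpha> k" and alpha_le: "\<And>k. \<alpha> k \<le> \<alpha> 0"
    and alpha_sum: "\<not> summable \<alpha>" and alpha_sq: "summable (\<lambda>k. (\<alpha> k)\<^sup>2)"
begin

abbreviation y :: "nat \<Rightarrow> (nat \<times> 'v \<Rightarrow> real) \<Rightarrow> 'v \<Rightarrow> real" where
  "y \<equiv> states E \<gamma> \<alpha> qmin qmax y0"

abbreviation A :: "nat \<Rightarrow> 'v \<Rightarrow> 'v \<Rightarrow> real" where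
  "A \<equiv> weights E \<gamma>"

definition x :: "nat \<Rightarrow> (nat \<times> 'v \<Rightarrow> real) \<Rightarrow> 'v \<Rightarrow> real" where
  "x k s j = quant qmin qmax (y k s j) (s (k, j))"

definition clipped :: "nat \<Rightarrow> (nat \<times> 'v \<Rightarrow> real) \<Rightarrow> 'v \<Rightarrow> real" where
  "clipped k s j = clip qmin qmax (y k s j)"

definition V :: "nat \<Rightarrow> (nat \<times> 'v \<Rightarrow> real) \<Rightarrow> real" where
  "V k s = (\<Sum>i\<in>UNIV. (y k s i - c)\<^sup>2)"

text \<open>Since \<open>U\<close> is at least 1, additive errors in the recursion for
  \<open>V\<close> become multiplicative ones for \<open>U\<close>.\<close>

definition U :: "nat \<Rightarrow> (nat \<times> 'v \<Rightarrow> real) \<Rightarrow> real" where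
  "U k s = 1 + V k s"

definition Q :: "nat \<Rightarrow> (nat \<times> 'v \<Rightarrow> real) \<Rightarrow> real" where
  "Q k s = dispersion E (clipped k s)"

definition linear_term :: "nat \<Rightarrow> (nat \<times> 'v \<Rightarrow> real) \<Rightarrow> real" where
  "linear_term k s = (\<Sum>i\<in>UNIV. (y k s i - c) * drift E (A k) (x k s) i)"

definition quadratic_term :: "nat \<Rightarrow> (nat \<times> 'v \<Rightarrow> real) \<Rightarrow> real" where
  "quadratic_term k s = (\<Sum>i\<in>UNIV. (drift E (A k) (x k s) i)\<^sup>2)"

lemma V_nonneg: "0 \<le> V k s"
  by (simp add: V_def sum_nonneg)

lemma U_ge_1: "1 \<le> U k s"
  using V_nonneg by (simp add: U_def)

lemma Q_nonneg: "0 \<le> Q k s"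
  by (simp add: Q_def dispersion_nonneg)

lemma y_Suc: "y (Suc k) s i = y k s i + \<alpha> k * drift E (A k) (x k s) i"
  unfolding states_Suc x_def ..

lemma U_Suc: "U (Suc k) s = U k s + 2 * \<alpha> k * linear_term k s + (\<alpha> k)\<^sup>2 * quadratic_term k s"
  unfolding U_def V_def linear_term_def quadratic_term_def y_Suc
  by (simp add: power2_eq_square sum.distrib[symmetric] sum_distrib_left algebra_simps)

lemma past_y: "past k (\<lambda>s. y k s i)"
proof (induction k arbitrary: i)
  case (Suc k)
  have "past (Suc k) (\<lambda>s. y k s i)" for i by (rule past_mono[OF Suc]) simp
  moreover have "past (Suc k) (\<lambda>s. x k s j)" for j
    unfolding x_def by (rule past_quant[OF Suc]) (use q in simp)
  ultimately show ?case
    unfolding y_Suc drift_def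
    by (intro past_add past_mult past_const past_sum past_diff)
qed (simp add: past_const)

lemma past_x: "past (Suc k) (\<lambda>s. x k s j)"
  unfolding x_def by (rule past_quant[OF past_y]) (use q in simp)

lemma past_clipped: "past k (\<lambda>s. clipped k s j)"
  unfolding clipped_def by (rule past_clip[OF past_y]) (use q in simp)

lemma past_V: "past k (V k)"
  unfolding V_def by (intro past_sum past_power2 past_diff past_y past_const)

lemma past_U: "past k (U k)"
  unfolding U_def by (intro past_add past_V past_const)

lemma past_Q: "past k (Q k)"
  unfolding Q_def dispersion_def case_prod_beta' by (intro past_sum past_power2 past_diff past_clipped)

lemma past_drift: "past (Suc k) (\<lambda>s. drift E (A k) (x k s) i)"
  unfolding drift_def by (intro past_add past_mult past_const past_sum past_diff past_x)

lemma past_linear_term: "past (Suc k) (linear_term k)"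
  unfolding linear_term_def
  by (intro past_sum past_mult past_diff past_const past_drift past_mono[OF past_y]) simp

lemma past_quadratic_term: "past (Suc k) (quadratic_term k)"
  unfolding quadratic_term_def by (intro past_sum past_power2 past_drift)

text \<open>In edge form every summand contains a single quantized value, multiplied by quantities
  known at time \<open>k\<close>, so unbiasedness applies edge by edge.\<close>

lemma integral_linear_term:
  assumes h: "past k h"
  shows "(\<integral>s. h s * linear_term k s \<partial>samples) =
    (\<integral>s. h s * (\<Sum>i\<in>UNIV. (y k s i - c) * drift E (A k) (clipped k s) i) \<partial>samples)"
proof -
  define f where "f e s = h s * (y k s (snd e) - y k s (fst e))" for e s
  have f: "past k (f e)" for e
    unfolding f_def by (intro past_mult past_diff past_y h)
  have expand: "h s * (\<Sum>i\<in>UNIV. (y k s i - c) * drift E (A k) z i) =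
      (\<Sum>e\<in>E. A k (snd e) (fst e) * (f e s * z (fst e)))" for s z
    unfolding sum_mult_drift f_def sum_distrib_left case_prod_beta' by (simp add: algebra_simps)
  have fx: "past (Suc k) (\<lambda>s. f e s * x k s (fst e))" for e
    by (intro past_mult past_x past_mono[OF f]) simp
  have fc: "past k (\<lambda>s. f e s * clipped k s (fst e))" for e
    by (intro past_mult past_clipped f)
  have "(\<integral>s. h s * linear_term k s \<partial>samples) =
      (\<Sum>e\<in>E. A k (snd e) (fst e) * (\<integral>s. f e s * x k s (fst e) \<partial>samples))"
    unfolding linear_term_def expand
    by (subst Bochner_Integration.integral_sum) (simp_all add: past_integrable[OF fx])
  also have "\<dots> = (\<Sum>e\<in>E. A k (snd e) (fst e) * (\<integral>s. f e s * clipped k s (fst e) \<partial>samples))"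
    unfolding x_def clipped_def integral_quant[OF f past_y q] ..
  also have "\<dots> = (\<integral>s. h s * (\<Sum>i\<in>UNIV. (y k s i - c) * drift E (A k) (clipped k s) i) \<partial>samples)"
    unfolding expand
    by (subst Bochner_Integration.integral_sum) (simp_all add: past_integrable[OF fc])
  finally show ?thesis .
qed

lemma gamma_nonneg: "0 \<le> \<gamma> k"
  using gamma(1)[of k] by (rule order_trans[rotated]) simp

lemma quadratic_term_bounded:
  obtains R where "\<And>k s. quadratic_term k s \<le> R"
proof -
  obtain C where C: "\<And>k i j. 0 \<le> A k i j" "\<And>k i j. A k i j \<le> C"
    by (rule weights_bounds[where \<gamma> = \<gamma>, OF sc gamma_nonneg], rule that)
  let ?D = "2 * real CARD('v) * C * (\<bar>qmin\<bar> + \<bar>qmax\<bar>)"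
  have "(drift E (A k) (x k s) i)\<^sup>2 \<le> ?D\<^sup>2" for k s i
  proof -
    have "\<bar>drift E (A k) (x k s) i\<bar> \<le> ?D"
      by (rule abs_drift_le[OF C]) (auto simp: x_def quant_def)
    then show ?thesis using power_mono[of "\<bar>drift E (A k) (x k s) i\<bar>" ?D 2] by simp
  qed
  then have "quadratic_term k s \<le> (\<Sum>i\<in>(UNIV::'v set). ?D\<^sup>2)" for k s
    unfolding quadratic_term_def by (rule sum_mono)
  then show thesis by (rule that)
qed

text \<open>The inequality of arithmetic and geometric means splits the product into two summable
  sequences of squares.\<close>

lemma summable_alpha_imbalance:
  "summable (\<lambda>k. \<alpha> k * (\<Sum>i\<in>UNIV. \<bar>imbalance E (A k) i\<bar>))"
proof (rule summable_comparison_test[OF _ summable_add[OF alpha_sq summable_imbalance_sq[OF sc gamma]]],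
    intro exI allI impI)
  fix k
  let ?S = "\<Sum>i\<in>UNIV. \<bar>imbalance E (A k) i\<bar>"
  have S: "?S \<ge> 0" by (intro sum_nonneg) auto
  have "2 * (\<alpha> k * ?S) \<le> (\<alpha> k)\<^sup>2 + ?S\<^sup>2" using sum_squares_bound[of "\<alpha> k" ?S] by simp
  moreover have "0 \<le> \<alpha> k * ?S" using S alpha_pos[of k] by simp
  ultimately show "norm (\<alpha> k * ?S) \<le> (\<alpha> k)\<^sup>2 + ?S\<^sup>2" by simp
qed

text \<open>The Robbins-Siegmund inequality E[U(k+1) | past] \<le> (1 + b_k) U(k) - \<alpha>(k) Q(k)
  in weak form, tested against nonnegative functions of the past.\<close>

definition energy_rate :: "(nat \<Rightarrow> real) \<Rightarrow> bool" where
  "energy_rate b \<longleftrightarrow> (\<forall>k. 0 \<le> b k) \<and> summable b \<and>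
    (\<forall>k h. past k h \<longrightarrow> (\<forall>s. 0 \<le> h s) \<longrightarrow>
      (\<integral>s. h s * U (Suc k) s \<partial>samples) \<le>
      (1 + b k) * (\<integral>s. h s * U k s \<partial>samples) - \<alpha> k * (\<integral>s. h s * Q k s \<partial>samples))"

lemma energy_rateD:
  assumes "energy_rate b"
  shows "0 \<le> b k" "summable b"
    "past k h \<Longrightarrow> (\<And>s. 0 \<le> h s) \<Longrightarrow> (\<integral>s. h s * U (Suc k) s \<partial>samples) \<le>
      (1 + b k) * (\<integral>s. h s * U k s \<partial>samples) - \<alpha> k * (\<integral>s. h s * Q k s \<partial>samples)"
  using assms by (auto simp: energy_rate_def)

lemma energy_rate_exists:
  obtains b where "energy_rate b"
proof -
  obtain R where R: "\<And>k s. quadratic_term k s \<le> R" using quadratic_term_bounded by blast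
  have R0: "0 \<le> R" using R[of 0 undefined] by (rule order_trans[rotated]) (simp add: quadratic_term_def sum_nonneg)
  have A: "1 \<le> A k i j" if "(j, i) \<in> E" for k i j
    using that node_weight_ge_1[of \<gamma> E k j, OF gamma_nonneg] by (simp add: weights_eq)
  define m where "m = \<bar>qmin\<bar> + \<bar>qmax\<bar>"
  define S where "S k = (\<Sum>i\<in>UNIV. \<bar>imbalance E (A k) i\<bar>)" for k
  \<comment> \<open>The first summand is the imbalance error of \<open>drift_descent\<close>; the
    second is the quadratic term, bounded by \<open>R\<close> and hence by
    \<open>R * U k s\<close>.\<close>
  define b where "b k = 2 * (m + 2 * m\<^sup>2) * (\<alpha> k * S k) + R * (\<alpha> k)\<^sup>2" for k
  have S: "S k \<ge> 0" for k by (auto simp: S_def intro!: sum_nonneg)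
  have "energy_rate b"
    unfolding energy_rate_def
  proof (intro conjI allI impI)
    show "0 \<le> b k" for k
      using S[of k] alpha_pos[of k] R0 by (simp add: b_def m_def)
    show "summable b"
      unfolding b_def S_def by (intro summable_add summable_mult summable_alpha_imbalance alpha_sq)
    fix k and h :: "(nat \<times> 'v \<Rightarrow> real) \<Rightarrow> real" assume h: "past k h" and h0: "\<forall>s. 0 \<le> h s"
    let ?W = "\<lambda>s. \<Sum>i\<in>UNIV. (y k s i - c) * drift E (A k) (clipped k s) i"
    have hS: "past (Suc k) h" by (rule past_mono[OF h]) simp
    have past_W: "past k ?W"
      unfolding drift_def
      by (intro past_sum past_mult past_add past_diff past_const past_y past_clipped)
    have iU: "integrable samples (\<lambda>s. h s * U k s)" and iW: "integrable samples (\<lambda>s. h s * ?W s)"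
      and iQ: "integrable samples (\<lambda>s. h s * Q k s)"
      by (intro past_integrable[of k] past_mult past_U h past_W past_Q)+
    have iL: "integrable samples (\<lambda>s. h s * linear_term k s)"
      and iR: "integrable samples (\<lambda>s. h s * quadratic_term k s)"
      by (intro past_integrable[of "Suc k"] past_mult hS past_linear_term past_quadratic_term)+
    have "(\<integral>s. h s * U (Suc k) s \<partial>samples) = (\<integral>s. h s * U k s + 2 * \<alpha> k * (h s * linear_term k s)
        + (\<alpha> k)\<^sup>2 * (h s * quadratic_term k s) \<partial>samples)"
      by (rule Bochner_Integration.integral_cong) (simp_all add: U_Suc algebra_simps)
    also have "\<dots> = (\<integral>s. h s * U k s \<partial>samples) + 2 * \<alpha> k * (\<integral>s. h s * linear_term k s \<partial>samples)
        + (\<alpha> k)\<^sup>2 * (\<integral>s. h s * quadratic_term k s \<partial>samples)"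
      using iU iL iR by simp
    also have "\<dots> = (\<integral>s. h s * U k s + 2 * \<alpha> k * (h s * ?W s)
        + (\<alpha> k)\<^sup>2 * (h s * quadratic_term k s) \<partial>samples)"
      unfolding integral_linear_term[OF h] using iU iW iR by simp
    also have "\<dots> \<le> (\<integral>s. (1 + b k) * (h s * U k s) - \<alpha> k * (h s * Q k s) \<partial>samples)"
    proof (rule integral_mono)
      fix s
      have "2 * ?W s \<le> 2 * (m + 2 * m\<^sup>2) * S k * U k s - Q k s"
        unfolding m_def S_def U_def V_def Q_def clipped_def by (rule drift_descent[OF A c])
      then have "\<alpha> k * (2 * ?W s) \<le> \<alpha> k * (2 * (m + 2 * m\<^sup>2) * S k * U k s - Q k s)"
        using alpha_pos[of k] by (intro mult_left_mono) auto
      moreover have "quadratic_term k s \<le> R * U k s"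
        using R[of k s] mult_left_mono[OF U_ge_1[of k s] R0] by simp
      then have "(\<alpha> k)\<^sup>2 * quadratic_term k s \<le> (\<alpha> k)\<^sup>2 * (R * U k s)"
        by (rule mult_left_mono) simp
      ultimately have "U k s + 2 * \<alpha> k * ?W s + (\<alpha> k)\<^sup>2 * quadratic_term k s
        \<le> (1 + b k) * U k s - \<alpha> k * Q k s"
        by (simp add: b_def algebra_simps)
      from mult_left_mono[OF this spec[OF h0, of s]]
      show "h s * U k s + 2 * \<alpha> k * (h s * ?W s) + (\<alpha> k)\<^sup>2 * (h s * quadratic_term k s)
        \<le> (1 + b k) * (h s * U k s) - \<alpha> k * (h s * Q k s)"
        by (simp only: distrib_left right_diff_distrib mult_ac)
    qed (use iU iW iR iQ in simp_all)
    also have "\<dots> = (1 + b k) * (\<integral>s. h s * U k s \<partial>samples) - \<alpha> k * (\<integral>s. h s * Q k s \<partial>samples)"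
      using iU iQ by simp
    finally show "(\<integral>s. h s * U (Suc k) s \<partial>samples) \<le>
      (1 + b k) * (\<integral>s. h s * U k s \<partial>samples) - \<alpha> k * (\<integral>s. h s * Q k s \<partial>samples)" .
  qed
  then show thesis by (rule that)
qed

text \<open>Clipping keeps \<open>Q\<close> bounded while \<open>V\<close> may be large; the second
  moment controls the part of the mean of \<open>V\<close> that \<open>Q\<close> cannot see.\<close>

lemma second_moment_bounded:
  obtains B where "\<And>k. (\<integral>s. (U k s)\<^sup>2 \<partial>samples) \<le> B"
proof -
  obtain R where R: "\<And>k s. quadratic_term k s \<le> R" using quadratic_term_bounded by blast
  have r0: "0 \<le> quadratic_term k s" for k s by (simp add: quadratic_term_def sum_nonneg)
  have R0: "0 \<le> R" using R r0 by (rule order_trans[rotated])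
  obtain b where "energy_rate b" by (rule energy_rate_exists)
  note b = energy_rateD(1,2)[OF this] and energy = energy_rateD(3)[OF this]
  \<comment> \<open>\<open>8 * R\<close> comes from Cauchy-Schwarz for the linear term, the rest
    from the quadratic term with \<alpha> bounded by its initial value.\<close>
  define K where "K = 8 * R + 2 * (\<alpha> 0)\<^sup>2 * R\<^sup>2"
  define a where "a k = 2 * b k + K * (\<alpha> k)\<^sup>2" for k
  have K: "0 \<le> K" using R0 by (simp add: K_def)
  have U0: "0 \<le> U k s" for k s using U_ge_1[of k s] by linarith
  have increment: "(U (Suc k) s - U k s)\<^sup>2 \<le> K * (\<alpha> k)\<^sup>2 * (U k s)\<^sup>2" for k s
  proof -
    let ?W = "linear_term k s" and ?r = "quadratic_term k s"
    have UU: "U k s \<le> (U k s)\<^sup>2" "1 \<le> (U k s)\<^sup>2"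
      using U_ge_1[of k s] by (auto intro: self_le_power one_le_power)
    have "?W\<^sup>2 \<le> V k s * ?r"
      unfolding linear_term_def V_def quadratic_term_def by (rule Cauchy_Schwarz_ineq_sum)
    also have "\<dots> \<le> U k s * R" using R r0 U0 V_nonneg by (intro mult_mono) (auto simp: U_def)
    also have "\<dots> \<le> (U k s)\<^sup>2 * R" using UU R0 by (intro mult_right_mono)
    finally have W: "8 * ?W\<^sup>2 \<le> 8 * R * (U k s)\<^sup>2" by (simp add: mult_ac)
    have "(\<alpha> k)\<^sup>2 * ?r\<^sup>2 \<le> (\<alpha> 0)\<^sup>2 * R\<^sup>2"
      using alpha_le[of k] alpha_pos[of k] R r0 by (intro mult_mono power_mono) (auto simp: less_imp_le)
    also have "\<dots> \<le> (\<alpha> 0)\<^sup>2 * R\<^sup>2 * (U k s)\<^sup>2"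
      using mult_left_mono[OF UU(2), of "(\<alpha> 0)\<^sup>2 * R\<^sup>2"] by simp
    finally have r: "2 * ((\<alpha> k)\<^sup>2 * ?r\<^sup>2) \<le> 2 * (\<alpha> 0)\<^sup>2 * R\<^sup>2 * (U k s)\<^sup>2" by simp
    have "(2 * ?W + \<alpha> k * ?r)\<^sup>2 \<le> 8 * ?W\<^sup>2 + 2 * ((\<alpha> k)\<^sup>2 * ?r\<^sup>2)"
      using zero_le_power2[of "2 * ?W - \<alpha> k * ?r"] by (simp add: power2_eq_square algebra_simps)
    also have "\<dots> \<le> K * (U k s)\<^sup>2" using W r by (simp add: K_def algebra_simps)
    finally have "(\<alpha> k)\<^sup>2 * (2 * ?W + \<alpha> k * ?r)\<^sup>2 \<le> (\<alpha> k)\<^sup>2 * (K * (U k s)\<^sup>2)"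
      by (rule mult_left_mono) simp
    moreover have "(U (Suc k) s - U k s)\<^sup>2 = (\<alpha> k)\<^sup>2 * (2 * ?W + \<alpha> k * ?r)\<^sup>2"
      unfolding U_Suc by (simp add: power2_eq_square algebra_simps)
    ultimately show ?thesis by (simp add: mult_ac)
  qed
  have step: "(\<integral>s. (U (Suc k) s)\<^sup>2 \<partial>samples) \<le> (1 + a k) * (\<integral>s. (U k s)\<^sup>2 \<partial>samples)" for k
  proof -
    have pU: "past (Suc k) (U k)" by (rule past_mono[OF past_U]) simp
    have i1: "integrable samples (\<lambda>s. U k s * U (Suc k) s)"
      and i2: "integrable samples (\<lambda>s. (U k s)\<^sup>2)" and i3: "integrable samples (\<lambda>s. (U (Suc k) s)\<^sup>2)"
      by (intro past_integrable[of "Suc k"] past_mult past_power2 pU past_U)+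
    \<comment> \<open>Expanding the squared increment leaves the mixed term
      \<open>U k s * U (Suc k) s\<close>, to which the energy inequality applies with test function
      \<open>h = U k\<close>.\<close>
    have "(\<integral>s. (U (Suc k) s)\<^sup>2 \<partial>samples) \<le>
        (\<integral>s. 2 * (U k s * U (Suc k) s) + (K * (\<alpha> k)\<^sup>2 - 1) * (U k s)\<^sup>2 \<partial>samples)"
    proof (rule integral_mono)
      fix s
      show "(U (Suc k) s)\<^sup>2 \<le> 2 * (U k s * U (Suc k) s) + (K * (\<alpha> k)\<^sup>2 - 1) * (U k s)\<^sup>2"
        using increment[of k s] by (simp add: power2_eq_square algebra_simps)
    qed (use i1 i2 i3 in simp_all)
    also have "\<dots> = 2 * (\<integral>s. U k s * U (Suc k) s \<partial>samples) + (K * (\<alpha> k)\<^sup>2 - 1) * (\<integral>s. (U k s)\<^sup>2 \<partial>samples)"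
      using i1 i2 by simp
    also have "(\<integral>s. U k s * U (Suc k) s \<partial>samples) \<le> (1 + b k) * (\<integral>s. (U k s)\<^sup>2 \<partial>samples)"
    proof -
      have "0 \<le> \<alpha> k * (\<integral>s. U k s * Q k s \<partial>samples)"
        using alpha_pos[of k] U0 Q_nonneg
        by (intro mult_nonneg_nonneg Bochner_Integration.integral_nonneg) (auto simp: less_imp_le)
      then show ?thesis
        using energy[OF past_U[of k] U0] by (simp add: power2_eq_square)
    qed
    finally show ?thesis by (simp add: a_def algebra_simps)
  qed
  show thesis
  proof
    show "(\<integral>s. (U k s)\<^sup>2 \<partial>samples) \<le> exp (suminf a) * (\<integral>s. (U 0 s)\<^sup>2 \<partial>samples)" for k
    proof (rule discrete_gronwall[of a, OF _ _ _ step])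
      show "0 \<le> a k" for k using b K by (simp add: a_def)
      show "summable a" unfolding a_def by (intro summable_add summable_mult b alpha_sq)
    qed simp
  qed
qed

lemma mean_states: "(\<Sum>i\<in>UNIV. y k s i) = real CARD('v) * c"
  unfolding sum_states by (rule mean)

text \<open>With \<open>h = 1\<close> the energy inequality telescopes. Gronwall bounds the mean of
  \<open>U\<close>, so the terms with \<open>b\<close> have a finite total.\<close>

lemma summable_dispersion:
  "summable (\<lambda>k. \<alpha> k * (\<integral>s. Q k s \<partial>samples))"
proof -
  obtain b where "energy_rate b" by (rule energy_rate_exists)
  note b = energy_rateD(1,2)[OF this] and energy = energy_rateD(3)[OF this]
  let ?u = "\<lambda>k. \<integral>s. U k s \<partial>samples" and ?g = "\<lambda>k. \<integral>s. Q k s \<partial>samples"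
  have U0: "0 \<le> U k s" for k s using U_ge_1[of k s] by linarith
  have u0: "0 \<le> ?u k" for k using U0 by simp
  have g0: "0 \<le> \<alpha> k * ?g k" for k
    using alpha_pos[of k] Q_nonneg by (intro mult_nonneg_nonneg) (auto simp: less_imp_le)
  have step: "?u (Suc k) \<le> (1 + b k) * ?u k - \<alpha> k * ?g k" for k
    using energy[of k "\<lambda>_. 1", OF past_const] by simp
  have bound: "?u k \<le> exp (suminf b) * ?u 0" for k
  proof (rule discrete_gronwall[of b ?u, OF b u0])
    show "?u (Suc k) \<le> (1 + b k) * ?u k" for k using step[of k] g0[of k] by linarith
  qed
  let ?C = "exp (suminf b) * ?u 0"
  have sum1: "(\<Sum>l<k. \<alpha> l * ?g l) \<le> ?u 0 - ?u k + (\<Sum>l<k. b l * ?C)" for k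
  proof (induction k)
    case (Suc k)
    show ?case using Suc step[of k] mult_left_mono[OF bound[of k] b(1)[of k]] by (simp add: algebra_simps)
  qed simp
  have sum2: "(\<Sum>l<k. b l * ?C) \<le> suminf b * ?C" for k
    unfolding sum_distrib_right[symmetric]
    by (intro mult_right_mono sum_le_suminf b ballI) (use u0 in auto)
  have "(\<Sum>l<k. \<alpha> l * ?g l) \<le> ?u 0 + suminf b * ?C" for k
    using sum1[of k] sum2[of k] u0[of k] by linarith
  then show ?thesis by (intro summableI_nonneg_bounded[OF g0])
qed

lemma deviation_arbitrarily_small:
  assumes e: "0 < e"
  obtains k where "m \<le> k" "(\<integral>s. V k s \<partial>samples) < e"
proof -
  obtain B where B: "\<And>k. (\<integral>s. (U k s)\<^sup>2 \<partial>samples) \<le> B" by (rule second_moment_bounded, rule that)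
  obtain K L where K: "0 \<le> K" and L: "0 \<le> L"
    and dev: "\<And>(y :: 'v \<Rightarrow> real) R. (\<Sum>i\<in>UNIV. y i) = real CARD('v) * c \<Longrightarrow> R > 0 \<Longrightarrow>
      (\<Sum>i\<in>UNIV. (y i - c)\<^sup>2) \<le> (K + L * R) * dispersion E (\<lambda>i. clip qmin qmax (y i))
        + (\<Sum>i\<in>UNIV. (y i - c)\<^sup>2)\<^sup>2 / R"
    by (rule deviation_le_dispersion[OF sc q c], rule that)
  \<comment> \<open>The level \<open>R\<close> is fixed first, to make the second moment term less
    than \<open>e / 2\<close>; only then \<open>d\<close>, whose choice depends on \<open>R\<close>,
    does the same for the dispersion term.\<close>
  define R where "R = 2 * (\<bar>B\<bar> + 1) / e"
  have R: "R > 0" using e by (simp add: R_def)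
  have KLR: "0 \<le> K + L * R" using K L R by simp
  define d where "d = e / (2 * (K + L * R + 1))"
  have d: "d > 0" using e KLR by (simp add: d_def)
  obtain k where k: "m \<le> k" "(\<integral>s. Q k s \<partial>samples) < d"
    using not_summable_weighted_small[of \<alpha> "\<lambda>k. \<integral>s. Q k s \<partial>samples", OF less_imp_le[OF alpha_pos] alpha_sum
      summable_dispersion d] by blast
  have iV: "integrable samples (V k)" and iQ: "integrable samples (Q k)"
    and iU: "integrable samples (\<lambda>s. (U k s)\<^sup>2)"
    by (intro past_integrable[of k] past_V past_Q past_power2 past_U)+
  have "(\<integral>s. V k s \<partial>samples) \<le> (\<integral>s. (K + L * R) * Q k s + (U k s)\<^sup>2 / R \<partial>samples)"
  proof (rule integral_mono)
    fix s
    have "V k s \<le> (K + L * R) * Q k s + (V k s)\<^sup>2 / R"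
      unfolding V_def Q_def clipped_def by (rule dev[OF mean_states R])
    also have "(V k s)\<^sup>2 / R \<le> (U k s)\<^sup>2 / R"
      using R V_nonneg[of k s] by (intro divide_right_mono power_mono) (auto simp: U_def)
    finally show "V k s \<le> (K + L * R) * Q k s + (U k s)\<^sup>2 / R" by simp
  qed (use iV iQ iU in auto)
  also have "\<dots> = (K + L * R) * (\<integral>s. Q k s \<partial>samples) + (\<integral>s. (U k s)\<^sup>2 \<partial>samples) / R"
    using iQ iU by simp
  also have "\<dots> \<le> (K + L * R) * d + \<bar>B\<bar> / R"
    using k(2) KLR B[of k] R by (intro add_mono mult_left_mono divide_right_mono) auto
  also have "\<dots> < e"
  proof -
    have "(K + L * R) * d < e / 2" using e KLR by (simp add: d_def field_simps)
    moreover have "\<bar>B\<bar> / R < e / 2" using e by (simp add: R_def field_simps)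
    ultimately show ?thesis by linarith
  qed
  finally show thesis using k(1) that by blast
qed

text \<open>Dividing \<open>U\<close> by the partial products and subtracting the limit of the reciprocals turns the energy
  inequality into a supermartingale property of a nonnegative process comparable to \<open>V\<close>.\<close>

lemma convergence:
  "(\<lambda>k. \<integral>s. V k s \<partial>samples) \<longlonglongrightarrow> 0" (is ?mean)
  "AE s in samples. (\<lambda>k. V k s) \<longlonglongrightarrow> 0" (is ?AE)
proof -
  obtain b where "energy_rate b" by (rule energy_rate_exists)
  note b = energy_rateD(1,2)[OF this] and energy = energy_rateD(3)[OF this]
  define P where "P k = (\<Prod>l<k. 1 + b l)" for k
  have P1: "1 \<le> P k" and P_le: "P k \<le> exp (suminf b)" for k
    unfolding P_def using prod_1_plus_bounds[OF b] by auto
  have P_Suc: "P (Suc k) = (1 + b k) * P k" for k by (simp add: P_def mult_ac)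
  have "incseq P"
  proof (rule incseq_SucI)
    show "P k \<le> P (Suc k)" for k
      using b(1)[of k] P1[of k] unfolding P_Suc by (simp add: algebra_simps)
  qed
  then obtain p where p: "P \<longlonglongrightarrow> p" "\<And>k. P k \<le> p"
    using P_le by (metis incseq_convergent)
  have p1: "1 \<le> p" using P1 p(2) by (rule order_trans)
  \<comment> \<open>Since \<open>U = 1 + V\<close>, \<open>Z\<close> is \<open>V / P\<close> plus
    \<open>1 / P - 1 / p\<close>. The latter is nonnegative and tends to 0, so the constant 1 leaves
    no trace in the limit.\<close>
  define Z where "Z k s = U k s / P k - 1 / p" for k s
  have past_Z: "past k (Z k)" for k
    unfolding Z_def divide_inverse by (intro past_diff past_mult past_U past_const)
  have Z_nonneg: "0 \<le> Z k s" for k s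
  proof -
    have "1 / p \<le> 1 / P k" using P1[of k] p(2)[of k] by (intro divide_left_mono) auto
    also have "\<dots> \<le> U k s / P k" using P1[of k] U_ge_1[of k s] by (intro divide_right_mono) auto
    finally show ?thesis by (simp add: Z_def)
  qed
  have V_le: "V k s \<le> p * Z k s" for k s
  proof -
    have "V k s = P k * Z k s + P k / p - 1" using P1[of k] by (simp add: Z_def U_def field_simps)
    also have "\<dots> \<le> P k * Z k s" using p(2)[of k] p1 by simp
    also have "\<dots> \<le> p * Z k s" using p(2) Z_nonneg by (rule mult_right_mono)
    finally show ?thesis .
  qed
  have Z_le: "Z k s \<le> V k s + (1 / P k - 1 / p)" for k s
  proof -
    have "V k s / P k \<le> V k s / 1" using P1[of k] V_nonneg by (intro divide_left_mono) auto
    then show ?thesis by (simp add: Z_def U_def add_divide_distrib)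
  qed
  have super: "(\<integral>s. h s * Z (Suc k) s \<partial>samples) \<le> (\<integral>s. h s * Z k s \<partial>samples)"
    if h: "past k h" and h0: "\<And>s. 0 \<le> h s" for k and h :: "(nat \<times> 'v \<Rightarrow> real) \<Rightarrow> real"
  proof -
    have hS: "past (Suc k) h" by (rule past_mono[OF h]) simp
    have i: "integrable samples h" "integrable samples (\<lambda>s. h s * U k s)"
      "integrable samples (\<lambda>s. h s * U (Suc k) s)"
      using h hS by (auto intro: past_integrable past_mult past_U)
    have expand: "(\<integral>s. h s * Z l s \<partial>samples) = (\<integral>s. h s * U l s \<partial>samples) / P l - (\<integral>s. h s \<partial>samples) / p"
      if "integrable samples (\<lambda>s. h s * U l s)" for l
      using that i(1) by (simp add: Z_def right_diff_distrib)
    have "0 \<le> \<alpha> k * (\<integral>s. h s * Q k s \<partial>samples)"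
      using alpha_pos[of k] h0 Q_nonneg
      by (intro mult_nonneg_nonneg Bochner_Integration.integral_nonneg) (auto simp: less_imp_le)
    then have "(\<integral>s. h s * U (Suc k) s \<partial>samples) \<le> (1 + b k) * (\<integral>s. h s * U k s \<partial>samples)"
      using energy[OF h h0] by linarith
    then have "(\<integral>s. h s * U (Suc k) s \<partial>samples) / P (Suc k) \<le>
        (1 + b k) * (\<integral>s. h s * U k s \<partial>samples) / P (Suc k)"
      using P1[of "Suc k"] by (intro divide_right_mono) auto
    also have "\<dots> = (\<integral>s. h s * U k s \<partial>samples) / P k"
      using b(1)[of k] by (simp add: P_Suc)
    finally show ?thesis unfolding expand[OF i(2)] expand[OF i(3)] by simp
  qed
  have iZ: "integrable samples (Z k)" and iV: "integrable samples (V k)" for k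
    by (intro past_integrable[of k] past_Z past_V)+
  let ?z = "\<lambda>k. \<integral>s. Z k s \<partial>samples"
  have z0: "0 \<le> ?z k" for k using Z_nonneg by simp
  have "?z (Suc k) \<le> ?z k" for k using super[of k "\<lambda>_. 1", OF past_const] by simp
  \<comment> \<open>The means decrease, so smallness at one late time persists; this upgrades
    \<open>deviation_arbitrarily_small\<close> to a limit.\<close>
  then have z_anti: "?z n \<le> ?z k" if "k \<le> n" for k n using that by (rule lift_Suc_antimono_le)
  have z_lim: "?z \<longlonglongrightarrow> 0"
  proof (rule LIMSEQ_I)
    fix r :: real assume r: "0 < r"
    have "(\<lambda>k. 1 / P k - 1 / p) \<longlonglongrightarrow> 1 / p - 1 / p"
      by (intro tendsto_intros p(1)) (use p1 in auto)
    then have "\<forall>\<^sub>F k in sequentially. 1 / P k - 1 / p < r / 2"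
      by (rule order_tendstoD(2)) (use r in simp)
    then obtain m where m: "\<And>k. m \<le> k \<Longrightarrow> 1 / P k - 1 / p < r / 2"
      by (auto simp: eventually_sequentially)
    obtain k where k: "m \<le> k" "(\<integral>s. V k s \<partial>samples) < r / 2"
      using deviation_arbitrarily_small[of "r / 2" m] r by auto
    have "?z k \<le> (\<integral>s. V k s + (1 / P k - 1 / p) \<partial>samples)"
      by (rule integral_mono) (use iZ iV Z_le in auto)
    also have "\<dots> = (\<integral>s. V k s \<partial>samples) + (1 / P k - 1 / p)"
      using iV by simp
    also have "\<dots> < r" using k m[OF k(1)] by linarith
    finally have "?z k < r" .
    then have "norm (?z n - 0) < r" if "k \<le> n" for n using z_anti[OF that] z0[of n] by simp
    then show "\<exists>no. \<forall>n\<ge>no. norm (?z n - 0) < r" by blast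
  qed
  show ?mean
  proof (rule tendsto_sandwich[OF _ _ tendsto_const])
    show "\<forall>\<^sub>F k in sequentially. 0 \<le> (\<integral>s. V k s \<partial>samples)" using V_nonneg by simp
    have "(\<integral>s. V k s \<partial>samples) \<le> (\<integral>s. p * Z k s \<partial>samples)" for k
      by (rule integral_mono) (use iZ iV V_le in auto)
    then show "\<forall>\<^sub>F k in sequentially. (\<integral>s. V k s \<partial>samples) \<le> p * ?z k" using iZ by simp
    show "(\<lambda>k. p * ?z k) \<longlonglongrightarrow> 0" using tendsto_mult_left[OF z_lim, of p] by simp
  qed
  have "AE s in samples. (\<lambda>k. Z k s) \<longlonglongrightarrow> 0"
  \<comment> \<open>Staying below \<open>e\<close> up to time \<open>k\<close> depends only on
    samples drawn before \<open>k\<close>, so its indicator is admissible in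
    \<open>super\<close>.\<close>
  proof (rule samples.AE_tendsto_0[OF iZ Z_nonneg _ z_lim])
    fix m k and e :: real
    show "(\<integral>s. indicator {s. \<forall>l\<in>{m..k}. Z l s < e} s * Z (Suc k) s \<partial>samples) \<le>
      (\<integral>s. indicator {s. \<forall>l\<in>{m..k}. Z l s < e} s * Z k s \<partial>samples)"
      by (rule super[OF past_indicator_less]) (auto intro: past_mono[OF past_Z])
  qed
  then show ?AE
  proof eventually_elim
    case (elim s)
    show ?case
    proof (rule tendsto_sandwich[OF _ _ tendsto_const])
      show "\<forall>\<^sub>F k in sequentially. 0 \<le> V k s" "\<forall>\<^sub>F k in sequentially. V k s \<le> p * Z k s"
        using V_nonneg V_le by simp_all
      show "(\<lambda>k. p * Z k s) \<longlonglongrightarrow> 0" using tendsto_mult_left[OF elim, of p] by simp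
    qed
  qed
qed

lemma AE_states_converge: "AE s in samples. \<forall>i. (\<lambda>k. y k s i) \<longlonglongrightarrow> c"
  using convergence(2)
proof eventually_elim
  case (elim s)
  show ?case
  proof
    fix i
    have "(\<lambda>k. (y k s i - c)\<^sup>2) \<longlonglongrightarrow> 0"
    proof (rule tendsto_sandwich[OF _ _ tendsto_const elim])
      show "\<forall>\<^sub>F k in sequentially. 0 \<le> (y k s i - c)\<^sup>2" by simp
      show "\<forall>\<^sub>F k in sequentially. (y k s i - c)\<^sup>2 \<le> V k s"
        unfolding V_def by (intro always_eventually allI member_le_sum) auto
    qed
    then have "(\<lambda>k. y k s i - c) \<longlonglongrightarrow> 0" by (simp add: power_tendsto_0_iff)
    then show "(\<lambda>k. y k s i) \<longlonglongrightarrow> c" by (simp add: LIM_zero_iff)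
  qed
qed

end

theorem theorem2:
  fixes E :: "('v::finite \<times> 'v) set"
    and \<gamma> \<alpha> :: "nat \<Rightarrow> real"
    and qmin qmax :: real
    and y0 :: "'v \<Rightarrow> real"
  defines "M \<equiv> PiM (UNIV :: (nat \<times> 'v) set) (\<lambda>_. uniform_measure lborel {0..1::real})"
    and "y \<equiv> states E \<gamma> \<alpha> qmin qmax y0"
    and "ybar \<equiv> (\<Sum>i\<in>UNIV. y0 i) / real CARD('v)"
  assumes no_loops: "\<forall>i. (i, i) \<notin> E"
    and sc: "strongly_connected E"
    and q: "qmin < qmax"
    and gamma: "\<forall>n k. 2 ^ n - 1 \<le> k \<and> k \<le> 2 ^ (n + 1) - 2 \<longrightarrow> \<gamma> k = 1 / 2 ^ n"
    and avg: "qmin \<le> ybar" "ybar \<le> qmax"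
    and alpha_pos: "\<forall>k. \<alpha> k > 0"
    and alpha_mono: "\<forall>k. \<alpha> (Suc k) \<le> \<alpha> k"
    and alpha_sum: "\<not> summable (\<lambda>k. \<alpha> (Suc k))"
    and alpha_sq: "summable (\<lambda>k. (\<alpha> (Suc k))\<^sup>2)"
  shows "measure M {\<omega> \<in> space M. \<forall>i. (\<lambda>k. y k \<omega> i) \<longlonglongrightarrow> ybar} = 1 \<and>
         (\<forall>k. integrable M (\<lambda>\<omega>. \<Sum>i\<in>UNIV. (y k \<omega> i - ybar)\<^sup>2)) \<and>
         (\<lambda>k. \<integral>\<omega>. (\<Sum>i\<in>UNIV. (y k \<omega> i - ybar)\<^sup>2) \<partial>M) \<longlonglongrightarrow> 0"
proof -
  interpret qc: quantized_consensus E \<gamma> \<alpha> qmin qmax ybar y0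
  proof
    show "\<alpha> k \<le> \<alpha> 0" for k
      by (rule lift_Suc_antimono_le[of \<alpha>]) (use alpha_mono in auto)
    \<comment> \<open>The given series start at index 1; adding the term at 0 does not affect
      summability.\<close>
    show "\<not> summable \<alpha>" using alpha_sum by (simp only: summable_Suc_iff[of \<alpha>] not_False_eq_True)
    show "summable (\<lambda>k. (\<alpha> k)\<^sup>2)"
      using alpha_sq by (simp only: summable_Suc_iff[of "\<lambda>k. (\<alpha> k)\<^sup>2"])
    show "(\<Sum>i\<in>UNIV. y0 i) = real CARD('v) * ybar" by (simp add: ybar_def)
    show "0 < \<alpha> k" for k using alpha_pos by blast
  qed (rule sc q avg dyadic_step_bounds[OF gamma])+
  have M: "M = samples" by (simp add: M_def samples_def)
  have [measurable]: "(\<lambda>s. states E \<gamma> \<alpha> qmin qmax y0 k s i) \<in> borel_measurable samples" for k i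
    using qc.past_y by (auto simp: past_def)
  have "{s \<in> space samples. \<forall>i. (\<lambda>k. states E \<gamma> \<alpha> qmin qmax y0 k s i) \<longlonglongrightarrow> ybar} \<in> sets samples"
    by measurable
  then have "measure M {s \<in> space M. \<forall>i. (\<lambda>k. y k s i) \<longlonglongrightarrow> ybar} = 1"
    using qc.AE_states_converge unfolding M y_def by (subst samples.prob_Collect_eq_1) auto
  moreover have "integrable M (\<lambda>s. \<Sum>i\<in>UNIV. (y k s i - ybar)\<^sup>2)" for k
    using past_integrable[OF qc.past_V] unfolding M y_def qc.V_def .
  moreover have "(\<lambda>k. \<integral>s. (\<Sum>i\<in>UNIV. (y k s i - ybar)\<^sup>2) \<partial>M) \<longlonglongrightarrow> 0"
    using qc.convergence(1) unfolding M y_def qc.V_def .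
  ultimately show ?thesis by blast
qed

end
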